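(* Consider the equation $$\frac{\partial u}{\partial t}(t,x)+u(t,x)\frac{\partial u}{\partial x}(t,x)=0. \qquad (\ast)$$ Let $\Phi$ be a $C^1$ diffeomorphism between two open and connected subsets of $\{(t,x,v): t,x,v\in\mathbf R\}=\mathbf R^3$ with the property that it maps graphs $\{(t,x,u(t,x)) : (t,x)\in D\}$ of local $C^1$ solutions $u$ of $(\ast)$ contained in its domain onto surfaces of the same kind. Then there exists a nonsingular $3\times 3$ real matrix $(s^i_j)_{i,j}$ such that, on the domain of $\Phi$, $$\Phi(t,x,v)=\left(\frac{s_1^1t+s_2^1x+s_3^1}{s_1^3t+s_2^3x+s_3^3},\ \frac{s_1^2t+s_2^2x+s_3^2}{s_1^3t+s_2^3x+s_3^3},\ \frac{[-\Delta_3^1t+\Delta_1^1]v+[\Delta_3^1x+\Delta_2^1]}{[-\Delta_3^2t+\Delta_1^2]v+[\Delta_3^2x+\Delta_2^2]}\right), \qquad (\ast\ast)$$ where $\Delta^i_j$ is the minor determinant obtained by deleting the $i$-th row and the $j$-th column from the matrix $(s^i_j)_{i,j}$. Conversely, every map $\Phi$ of the form $(\ast\ast)$ sends graphs of local classical solutions of $(\ast)$ contained in its domain into graphs of local classical solutions of $(\ast)$.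
   Context: A local $C^1$ (classical) solution of $(\ast)$ is a $C^1$ function $u:D\to\mathbf R$ on an open set $D\subseteq\mathbf R^2$ satisfying $(\ast)$ on $D$. In $(s^i_j)$ the upper index $i$ is the row index and the lower index $j$ is the column index; $\Delta^i_j$ is the (unsigned) $2\times2$ minor. *)

theory Defs
  imports "HOL-Analysis.Analysis"
begin

text \<open>A point \<open>(t, x, v)\<close> of three-space is a triple of reals, a point \<open>(t, x)\<close> of the plane a pair.\<close>

text \<open>Derivatives are not taken relative to \<open>S\<close>, so this is the usual notion for open \<open>S\<close>.\<close>

definition C1_on :: "'a::real_normed_vector set \<Rightarrow> ('a \<Rightarrow> 'b::real_normed_vector) \<Rightarrow> bool" where
  "C1_on S f \<longleftrightarrow>
     (\<exists>f' :: 'a \<Rightarrow> 'a \<Rightarrow>\<^sub>L 'b.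
        (\<forall>p\<in>S. (f has_derivative blinfun_apply (f' p)) (at p)) \<and> continuous_on S f')"

definition C1_diffeomorphism ::
    "'a::real_normed_vector set \<Rightarrow> 'b::real_normed_vector set \<Rightarrow> ('a \<Rightarrow> 'b) \<Rightarrow> bool" where
  "C1_diffeomorphism U V \<Phi> \<longleftrightarrow>
     bij_betw \<Phi> U V \<and> C1_on U \<Phi> \<and> C1_on V (the_inv_into U \<Phi>)"

text \<open>The open set \<open>D\<close> is neither required to be connected nor to be nonempty.\<close>

definition local_C1_solution :: "(real \<times> real) set \<Rightarrow> (real \<times> real \<Rightarrow> real) \<Rightarrow> bool" where
  "local_C1_solution D u \<longleftrightarrow>
     open D \<and> C1_on D u \<and>
     (\<forall>(t, x)\<in>D. deriv (\<lambda>\<tau>. u (\<tau>, x)) t + u (t, x) * deriv (\<lambda>\<xi>. u (t, \<xi>)) x = 0)"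

definition graph_over :: "(real \<times> real) set \<Rightarrow> (real \<times> real \<Rightarrow> real) \<Rightarrow> (real \<times> real \<times> real) set" where
  "graph_over D u = {(t, x, u (t, x)) | t x. (t, x) \<in> D}"

definition solution_graph :: "(real \<times> real \<times> real) set \<Rightarrow> bool" where
  "solution_graph G \<longleftrightarrow> (\<exists>D u. local_C1_solution D u \<and> G = graph_over D u)"

definition preserves_solution_graphs ::
    "(real \<times> real \<times> real) set \<Rightarrow> (real \<times> real \<times> real \<Rightarrow> real \<times> real \<times> real) \<Rightarrow> bool" where
  "preserves_solution_graphs U \<Phi> \<longleftrightarrow>
     (\<forall>G. solution_graph G \<and> G \<subseteq> U \<longrightarrow> solution_graph (\<Phi> ` G))"

text \<open>For \<open>i\<close> in \<open>{1, 2, 3}\<close>, \<open>skip i\<close> enumerates the two remaining indices in the order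
  \<open>1 < 2 < 3\<close>. (The library order on the index type \<open>3\<close> is not used: there \<open>3 = 0\<close> is least.)\<close>

definition skip :: "3 \<Rightarrow> 2 \<Rightarrow> 3" where
  "skip i k = (if k = 1 then (if i = 1 then 2 else 1) else (if i = 3 then 2 else 3))"

text \<open>The minor \<open>\<Delta>\<close> with upper index \<open>i\<close> (deleted row) and lower index \<open>j\<close> (deleted column),
  without the cofactor sign.\<close>

definition minor_det :: "real^3^3 \<Rightarrow> 3 \<Rightarrow> 3 \<Rightarrow> real" where
  "minor_det s i j = det (\<chi> k l. s $ skip i k $ skip j l :: real^2^2)"

definition lin_form :: "real^3^3 \<Rightarrow> 3 \<Rightarrow> real \<Rightarrow> real \<Rightarrow> real" where
  "lin_form s i t x = s $ i $ 1 * t + s $ i $ 2 * x + s $ i $ 3"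

definition vel_form :: "real^3^3 \<Rightarrow> 3 \<Rightarrow> real \<Rightarrow> real \<Rightarrow> real \<Rightarrow> real" where
  "vel_form s i t x v =
     (- minor_det s i 3 * t + minor_det s i 1) * v + (minor_det s i 3 * x + minor_det s i 2)"

definition projective_lift :: "real^3^3 \<Rightarrow> real \<times> real \<times> real \<Rightarrow> real \<times> real \<times> real" where
  "projective_lift s = (\<lambda>(t, x, v).
     (lin_form s 1 t x / lin_form s 3 t x,
      lin_form s 2 t x / lin_form s 3 t x,
      vel_form s 1 t x v / vel_form s 2 t x v))"

text \<open>The points at which the three quotients are meaningful; division by zero is total here.\<close>

definition projective_lift_domain :: "real^3^3 \<Rightarrow> (real \<times> real \<times> real) set" where
  "projective_lift_domain s =
     {(t, x, v). lin_form s 3 t x \<noteq> 0 \<and> vel_form s 2 t x v \<noteq> 0}"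

definition has_projective_form ::
    "real^3^3 \<Rightarrow> (real \<times> real \<times> real) set \<Rightarrow> (real \<times> real \<times> real \<Rightarrow> real \<times> real \<times> real) \<Rightarrow> bool" where
  "has_projective_form s U \<Phi> \<longleftrightarrow>
     U \<subseteq> projective_lift_domain s \<and> (\<forall>p\<in>U. \<Phi> p = projective_lift s p)"

end

theory Submission
  imports Defs
begin

text \<open>Let \<open>\<Phi> = (T, Y, w)\<close> preserve solution graphs. A solution may live on a disconnected domain, so
  two constant solutions over disjoint discs form one solution; hence \<open>\<Phi>\<^sup>-\<^sup>1\<close> maps points over
  one point of the \<open>(t, x)\<close>-plane to points over one point. Comparing a constant solution with
  \<open>(x - c) / (t - d)\<close> shows that \<open>\<Phi>\<close> maps characteristic directions \<open>(1, v, 0)\<close> to characteristic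
  directions. Therefore \<open>T\<close> and \<open>Y\<close> are locally functions of \<open>(t, x)\<close>, while \<open>w\<close> and \<open>Y - w T\<close> are
  constant on the lines \<open>x = x0 + c + v (t - t0)\<close>, \<open>v\<close> constant.

  Only first derivatives are available. Differentiating these constants with respect to the line
  shows that on each line \<open>w\<^sub>v\<close> and \<open>w\<^sub>v T\<close> are affine in time, and that \<open>J w\<^sub>v\<^sup>3\<close> is constant, where
  \<open>J\<close> is the Jacobian of \<open>(T, Y)\<close>. Hence \<open>L = J\<^bsup>-1/3\<^esup>\<close> together with \<open>L T\<close> and \<open>L Y\<close> is affine along
  all lines with slopes near a given one, and three directions suffice to make them affine in
  \<open>(t, x)\<close>: locally \<open>(T, Y)\<close> is a projective map, and \<open>w\<close> is the slope of the image line. Two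
  matrices that agree on an open set are proportional, so connectedness makes the form global.

  Conversely, a projective map of the plane maps lines to lines and \<open>\<Phi>\<close> records the slope of the
  image, so that the chain rule along characteristics gives the equation for the image graph.\<close>

subsection \<open>Maps of class C1\<close>

lemma C1_onI:
  fixes f' :: "'a::real_normed_vector \<Rightarrow> 'a \<Rightarrow>\<^sub>L 'b::real_normed_vector"
  assumes "\<And>p. p \<in> S \<Longrightarrow> (f has_derivative blinfun_apply (f' p)) (at p)"
    and "continuous_on S f'"
  shows "C1_on S f"
  using assms unfolding C1_on_def by blast

lemma C1_onE:
  assumes "C1_on S f"
  obtains f' :: "'a::real_normed_vector \<Rightarrow> 'a \<Rightarrow>\<^sub>L 'b::real_normed_vector"
  where "\<And>p. p \<in> S \<Longrightarrow> (f has_derivative blinfun_apply (f' p)) (at p)"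
    and "continuous_on S f'"
  using assms unfolding C1_on_def by blast

lemma C1_on_imp_continuous_on:
  assumes "C1_on S f"
  shows "continuous_on S f"
  using assms by (metis C1_onE has_derivative_continuous continuous_at_imp_continuous_on)

lemma C1_on_bounded_linear:
  assumes "bounded_linear f"
  shows "C1_on S f"
proof (rule C1_onI)
  show "(f has_derivative blinfun_apply (Blinfun f)) (at p)" for p
    using assms by (simp add: bounded_linear_Blinfun_apply bounded_linear_imp_has_derivative)
qed simp

lemma C1_on_const: "C1_on S (\<lambda>p. c)"
  by (rule C1_onI[where f' = "\<lambda>_. 0"]) (auto simp: zero_blinfun.rep_eq)

lemma C1_on_add:
  assumes "C1_on S f" "C1_on S g"
  shows "C1_on S (\<lambda>p. f p + g p)"
proof -
  obtain f' g' where *: "\<And>p. p \<in> S \<Longrightarrow> (f has_derivative blinfun_apply (f' p)) (at p)" "continuous_on S f'"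
    "\<And>p. p \<in> S \<Longrightarrow> (g has_derivative blinfun_apply (g' p)) (at p)" "continuous_on S g'"
    using assms by (metis C1_onE)
  show ?thesis
  proof (rule C1_onI)
    show "((\<lambda>p. f p + g p) has_derivative blinfun_apply (f' p + g' p)) (at p)" if "p \<in> S" for p
      unfolding plus_blinfun.rep_eq by (intro derivative_intros * that)
  qed (intro continuous_intros *)
qed

lemma C1_on_mult:
  fixes f g :: "'a::real_normed_vector \<Rightarrow> real"
  assumes "C1_on S f" "C1_on S g"
  shows "C1_on S (\<lambda>p. f p * g p)"
proof -
  obtain f' g' where *: "\<And>p. p \<in> S \<Longrightarrow> (f has_derivative blinfun_apply (f' p)) (at p)" "continuous_on S f'"
    "\<And>p. p \<in> S \<Longrightarrow> (g has_derivative blinfun_apply (g' p)) (at p)" "continuous_on S g'"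
    using assms by (metis C1_onE)
  show ?thesis
  proof (rule C1_onI)
    show "((\<lambda>p. f p * g p) has_derivative blinfun_apply (f p *\<^sub>R g' p + g p *\<^sub>R f' p)) (at p)" if "p \<in> S" for p
      by (rule has_derivative_eq_rhs, rule has_derivative_mult[OF *(1,3)[OF that]])
        (simp add: blinfun.bilinear_simps fun_eq_iff)
  qed (intro continuous_intros * C1_on_imp_continuous_on assms)
qed

lemma C1_on_inverse:
  fixes f :: "'a::real_normed_vector \<Rightarrow> real"
  assumes "C1_on S f" "\<And>p. p \<in> S \<Longrightarrow> f p \<noteq> 0"
  shows "C1_on S (\<lambda>p. inverse (f p))"
proof -
  obtain f' where *: "\<And>p. p \<in> S \<Longrightarrow> (f has_derivative blinfun_apply (f' p)) (at p)" "continuous_on S f'"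
    using assms by (metis C1_onE)
  show ?thesis
  proof (rule C1_onI)
    show "((\<lambda>p. inverse (f p)) has_derivative blinfun_apply ((- (inverse (f p) * inverse (f p))) *\<^sub>R f' p)) (at p)"
      if "p \<in> S" for p
      by (rule has_derivative_eq_rhs, rule Deriv.has_derivative_inverse[OF assms(2)[OF that] *(1)[OF that]])
        (simp add: blinfun.bilinear_simps fun_eq_iff)
  qed (use assms(2) in \<open>intro continuous_intros * C1_on_imp_continuous_on assms; blast\<close>)
qed

lemma C1_on_compose:
  assumes f: "C1_on S f" and g: "C1_on R g" and "f ` S \<subseteq> R"
  shows "C1_on S (\<lambda>p. g (f p))"
proof -
  obtain f' g' where *: "\<And>p. p \<in> S \<Longrightarrow> (f has_derivative blinfun_apply (f' p)) (at p)" "continuous_on S f'"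
    "\<And>p. p \<in> R \<Longrightarrow> (g has_derivative blinfun_apply (g' p)) (at p)" "continuous_on R g'"
    using f g by (metis C1_onE)
  show ?thesis
  proof (rule C1_onI)
    show "((\<lambda>p. g (f p)) has_derivative blinfun_apply (g' (f p) o\<^sub>L f' p)) (at p)" if "p \<in> S" for p
      using has_derivative_compose[OF *(1)[OF that] *(3), of] that assms(3)
      by (simp add: blinfun_compose.rep_eq o_def image_subset_iff)
    show "continuous_on S (\<lambda>p. g' (f p) o\<^sub>L f' p)"
      by (intro bounded_bilinear.continuous_on[OF bounded_bilinear_blinfun_compose] *(2)
          continuous_on_compose2[OF *(4) C1_on_imp_continuous_on[OF f] assms(3)])
  qed
qed

lemma C1_on_Pair:
  assumes "C1_on S f" "C1_on S g"
  shows "C1_on S (\<lambda>p. (f p, g p))"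
proof -
  have "C1_on S (\<lambda>p. (f p, 0) + (0, g p))"
    by (intro C1_on_add C1_on_compose[OF assms(1), of UNIV "\<lambda>y. (y, 0)"]
        C1_on_compose[OF assms(2), of UNIV "\<lambda>y. (0, y)"] C1_on_bounded_linear
        bounded_linear_Pair bounded_linear_ident bounded_linear_zero) auto
  then show ?thesis by simp
qed

lemma C1_on_diff:
  fixes f g :: "'a::real_normed_vector \<Rightarrow> real"
  assumes "C1_on S f" "C1_on S g"
  shows "C1_on S (\<lambda>p. f p - g p)"
  using C1_on_add[OF assms(1) C1_on_mult[OF C1_on_const[of _ "-1"] assms(2)]] by simp

lemma C1_on_divide:
  fixes f g :: "'a::real_normed_vector \<Rightarrow> real"
  assumes "C1_on S f" "C1_on S g" "\<And>p. p \<in> S \<Longrightarrow> g p \<noteq> 0"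
  shows "C1_on S (\<lambda>p. f p / g p)"
  unfolding divide_inverse by (intro C1_on_mult C1_on_inverse assms)

lemma C1_on_fst: "C1_on S fst" and C1_on_snd: "C1_on S snd"
  by (simp_all add: C1_on_bounded_linear bounded_linear_fst bounded_linear_snd)

lemma C1_on_lin_form: "C1_on S (\<lambda>p. lin_form s i (fst p) (snd p))"
  unfolding lin_form_def by (intro C1_on_add C1_on_mult C1_on_const C1_on_fst C1_on_snd)

lemma C1_on_vel_form:
  assumes "C1_on S u"
  shows "C1_on S (\<lambda>p. vel_form s i (fst p) (snd p) (u p))"
  unfolding vel_form_def by (intro C1_on_add C1_on_mult C1_on_const C1_on_fst C1_on_snd assms)

section \<open>The equation as a directional derivative along characteristics\<close>

text \<open>By linearity of the total derivative, the two partial derivatives combine into its value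
  at the characteristic direction \<open>(1, u)\<close>. Later arguments use the equation only in
  this form.\<close>

lemma burgers_operator_eq:
  fixes u :: "real \<times> real \<Rightarrow> real"
  assumes "(u has_derivative d) (at (t, x))"
  shows "deriv (\<lambda>\<tau>. u (\<tau>, x)) t + u (t, x) * deriv (\<lambda>\<xi>. u (t, \<xi>)) x = d (1, u (t, x))"
proof -
  interpret d: bounded_linear d using assms has_derivative_bounded_linear by blast
  have p: "((\<lambda>\<tau>. (\<tau>, x)) has_derivative (\<lambda>h. (h, 0))) (at t)"
    "((\<lambda>\<xi>. (t, \<xi>)) has_derivative (\<lambda>h. (0, h))) (at x)"
    by (auto intro!: derivative_eq_intros)
  note 1 = has_derivative_compose[OF p(1) assms] and 2 = has_derivative_compose[OF p(2) assms]
  have "d (h, 0) = d (1, 0) * h" "d (0, h) = d (0, 1) * h" for h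
    using d.scaleR[of h "(1,0)"] d.scaleR[of h "(0,1)"] by (simp_all only: scaleR_Pair) (simp_all add: mult.commute)
  then have d: "(\<lambda>h. d (h, 0)) = (*) (d (1, 0))" "(\<lambda>h. d (0, h)) = (*) (d (0, 1))"
    by (intro ext, blast)+
  have "deriv (\<lambda>\<tau>. u (\<tau>, x)) t = d (1, 0)" "deriv (\<lambda>\<xi>. u (t, \<xi>)) x = d (0, 1)"
    using 1 2 by (simp_all add: d DERIV_imp_deriv has_field_derivative_def)
  moreover have "d (1, u (t, x)) = d (1, 0) + u (t, x) * d (0, 1)"
    using d.add[of "(1,0)" "(0, u (t, x))"] fun_cong[OF d(2), of "u (t, x)"] by simp
  ultimately show ?thesis by simp
qed

lemma local_C1_solutionD:
  assumes "local_C1_solution D u" "(t, x) \<in> D"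
  obtains d where "(u has_derivative d) (at (t, x))" "d (1, u (t, x)) = 0"
proof -
  obtain u' where "(u has_derivative blinfun_apply u') (at (t, x))"
    using assms by (auto simp: local_C1_solution_def C1_on_def)
  moreover from assms have "deriv (\<lambda>\<tau>. u (\<tau>, x)) t + u (t, x) * deriv (\<lambda>\<xi>. u (t, \<xi>)) x = 0"
    by (auto simp: local_C1_solution_def)
  ultimately show thesis
    using that burgers_operator_eq by metis
qed

lemma local_C1_solutionI:
  assumes "open D" "C1_on D u"
    and "\<And>t x d. (t, x) \<in> D \<Longrightarrow> (u has_derivative d) (at (t, x)) \<Longrightarrow> d (1, u (t, x)) = 0"
  shows "local_C1_solution D u"
  unfolding local_C1_solution_def
proof (intro conjI assms ballI, clarify)
  fix t x
  assume tx: "(t, x) \<in> D"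
  with assms(2) obtain d where d: "(u has_derivative d) (at (t, x))"
    unfolding C1_on_def by blast
  show "deriv (\<lambda>\<tau>. u (\<tau>, x)) t + u (t, x) * deriv (\<lambda>\<xi>. u (t, \<xi>)) x = 0"
    unfolding burgers_operator_eq[OF d] by (rule assms(3)[OF tx d])
qed

section \<open>Minors and homogeneous coordinates of the plane\<close>

lemma minor_det_simps:
  "minor_det s 1 1 = s$2$2 * s$3$3 - s$2$3 * s$3$2"
  "minor_det s 1 2 = s$2$1 * s$3$3 - s$2$3 * s$3$1"
  "minor_det s 1 3 = s$2$1 * s$3$2 - s$2$2 * s$3$1"
  "minor_det s 2 1 = s$1$2 * s$3$3 - s$1$3 * s$3$2"
  "minor_det s 2 2 = s$1$1 * s$3$3 - s$1$3 * s$3$1"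
  "minor_det s 2 3 = s$1$1 * s$3$2 - s$1$2 * s$3$1"
  by (simp_all add: minor_det_def skip_def det_2)

text \<open>Homogeneous coordinates of \<open>(t, x)\<close>. They turn the fractional map
  \<open>plane_map s\<close> into the linear action of \<open>s\<close>, so that inverting the map
  becomes inverting the matrix.\<close>

definition hom_vec :: "real \<Rightarrow> real \<Rightarrow> real^3" where
  "hom_vec t x = vector [t, x, 1]"

lemma hom_vec_nth [simp]: "hom_vec t x $ 1 = t" "hom_vec t x $ 2 = x" "hom_vec t x $ 3 = 1"
  by (simp_all add: hom_vec_def)

lemma lin_form_eq: "lin_form s i t x = (s *v hom_vec t x) $ i"
  by (simp add: lin_form_def matrix_vector_mult_def sum_3)

definition plane_map :: "real^3^3 \<Rightarrow> real \<times> real \<Rightarrow> real \<times> real" where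
  "plane_map s q = (lin_form s 1 (fst q) (snd q) / lin_form s 3 (fst q) (snd q),
     lin_form s 2 (fst q) (snd q) / lin_form s 3 (fst q) (snd q))"

lemma hom_vec_plane_map:
  assumes "lin_form s 3 t x \<noteq> 0" "plane_map s (t, x) = (t', x')"
  shows "s *v hom_vec t x = lin_form s 3 t x *\<^sub>R hom_vec t' x'"
  using assms by (auto simp: vec_eq_iff forall_3 plane_map_def simp flip: lin_form_eq)

text \<open>Applying \<open>r\<close> to \<open>s *v hom_vec t x = l *\<^sub>R hom_vec t' x'\<close>
  recovers \<open>hom_vec t x\<close>. Its third coordinate, which is 1, shows that the two
  denominators are reciprocal, and the other two coordinates give the inverse map.\<close>

lemma plane_map_inverse:
  assumes "r ** s = mat 1" "lin_form s 3 t x \<noteq> 0" "plane_map s (t, x) = (t', x')"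
  shows "lin_form r 3 t' x' \<noteq> 0" "plane_map r (t', x') = (t, x)"
proof -
  let ?l = "lin_form s 3 t x"
  have "hom_vec t x = r *v (s *v hom_vec t x)"
    by (simp add: matrix_vector_mul_assoc assms(1))
  also have "\<dots> = ?l *\<^sub>R (r *v hom_vec t' x')"
    by (simp add: hom_vec_plane_map[OF assms(2,3)] matrix_vector_mult_scaleR)
  finally have *: "hom_vec t x $ i = ?l * lin_form r i t' x'" for i
    by (simp add: lin_form_eq vec_eq_iff)
  have l: "?l * lin_form r 3 t' x' = 1"
    using *[of 3] by simp
  then show nz: "lin_form r 3 t' x' \<noteq> 0"
    by auto
  from l nz have "?l = 1 / lin_form r 3 t' x'"
    by (metis nonzero_mult_div_cancel_right)
  then have "lin_form r i t' x' / lin_form r 3 t' x' = hom_vec t x $ i" for i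
    unfolding *[of i] by simp
  then show "plane_map r (t', x') = (t, x)"
    by (simp add: plane_map_def)
qed

subsection \<open>Projective maps preserve solution graphs\<close>

lemma has_vector_derivative_compose:
  assumes "(f has_vector_derivative f') (at x)" "(g has_derivative g') (at (f x))"
  shows "((\<lambda>x. g (f x)) has_vector_derivative g' f') (at x)"
  using vector_derivative_diff_chain_within[OF assms(1) has_derivative_at_withinI[OF assms(2)]]
  by (simp add: o_def)

lemma lin_form_along_line_deriv:
  "((\<lambda>h. lin_form s i (t + h) (x + h * v)) has_real_derivative s$i$1 + s$i$2 * v) (at h)"
  unfolding lin_form_def by (auto intro!: derivative_eq_intros)

text \<open>This is where the third component of \<open>projective_lift\<close> comes from: by the
  quotient rule the image of a line of slope \<open>v\<close> moves with velocity proportional to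
  \<open>(vel_form s 2, vel_form s 1)\<close>, so the quotient of the two is the slope of the image
  line.\<close>

lemma plane_map_along_line_deriv:
  assumes "lin_form s 3 t x \<noteq> 0"
  shows "((\<lambda>h. plane_map s (t + h, x + h * v)) has_vector_derivative
    (vel_form s 2 t x v / (lin_form s 3 t x)\<^sup>2, vel_form s 1 t x v / (lin_form s 3 t x)\<^sup>2)) (at 0)"
proof -
  have *: "((\<lambda>h. lin_form s i (t + h) (x + h * v) / lin_form s 3 (t + h) (x + h * v)) has_real_derivative
    ((s$i$1 + s$i$2 * v) * lin_form s 3 t x - lin_form s i t x * (s$3$1 + s$3$2 * v)) / (lin_form s 3 t x)\<^sup>2) (at 0)" for i
    using assms by (auto intro!: derivative_eq_intros lin_form_along_line_deriv simp: power2_eq_square)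
  have e: "(s$1$1 + s$1$2 * v) * lin_form s 3 t x - lin_form s 1 t x * (s$3$1 + s$3$2 * v) = vel_form s 2 t x v"
    "(s$2$1 + s$2$2 * v) * lin_form s 3 t x - lin_form s 2 t x * (s$3$1 + s$3$2 * v) = vel_form s 1 t x v"
    by (simp_all add: lin_form_def vel_form_def minor_det_simps algebra_simps)
  show ?thesis
    unfolding plane_map_def using *[of 1] *[of 2]
    by (auto intro!: has_vector_derivative_Pair simp: e has_real_derivative_iff_has_vector_derivative)
qed

text \<open>The image graph is that of \<open>vel\<close> transported by the inverse plane map. Its
  derivative along the image of a characteristic is computed twice, by the chain rule and as zero
  because \<open>vel\<close> is stationary along the original characteristic.\<close>

lemma projective_image_solution_graph:
  assumes inv: "r ** s = mat 1" "s ** r = mat 1"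
    and form: "has_projective_form s U \<Phi>"
    and sol: "local_C1_solution D u" and sub: "graph_over D u \<subseteq> U"
  shows "solution_graph (\<Phi> ` graph_over D u)"
proof -
  define vel where "vel p = vel_form s 1 (fst p) (snd p) (u p) / vel_form s 2 (fst p) (snd p) (u p)" for p
  define u' where "u' q = vel (plane_map r q)" for q
  \<comment> \<open>Division is total, so points with vanishing denominator, whose preimage is only
    a default value, are excluded explicitly.\<close>
  define D' where "D' = {q. lin_form r 3 (fst q) (snd q) \<noteq> 0} \<inter> plane_map r -` D"
  have D: "open D" "C1_on D u"
    using sol by (auto simp: local_C1_solution_def)
  have dom: "lin_form s 3 t x \<noteq> 0" "vel_form s 2 t x (u (t, x)) \<noteq> 0"
    and \<Phi>: "\<Phi> (t, x, u (t, x)) = (fst (plane_map s (t, x)), snd (plane_map s (t, x)), vel (t, x))"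
    if "(t, x) \<in> D" for t x
  proof -
    from that sub have "(t, x, u (t, x)) \<in> U" by (auto simp: graph_over_def)
    with form show "lin_form s 3 t x \<noteq> 0" "vel_form s 2 t x (u (t, x)) \<noteq> 0"
      "\<Phi> (t, x, u (t, x)) = (fst (plane_map s (t, x)), snd (plane_map s (t, x)), vel (t, x))"
      by (auto simp: has_projective_form_def projective_lift_domain_def projective_lift_def plane_map_def vel_def)
  qed
  have fwd: "plane_map s p \<in> D'" "plane_map r (plane_map s p) = p" if "p \<in> D" for p
  proof -
    obtain t x t' x' where p: "p = (t, x)" "plane_map s (t, x) = (t', x')" by fastforce
    then have "lin_form s 3 t x \<noteq> 0" using that dom by auto
    from plane_map_inverse[OF inv(1) this p(2)] show "plane_map s p \<in> D'" "plane_map r (plane_map s p) = p"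
      using that by (auto simp: p D'_def)
  qed
  have bwd: "plane_map s (plane_map r q) = q" if "q \<in> D'" for q
  proof -
    obtain t x t' x' where q: "q = (t', x')" "plane_map r (t', x') = (t, x)" by fastforce
    with that have "lin_form r 3 t' x' \<noteq> 0" by (auto simp: D'_def)
    from plane_map_inverse(2)[OF inv(2) this q(2)] show ?thesis
      by (simp add: q)
  qed
  let ?N = "{q. lin_form r 3 (fst q) (snd q) \<noteq> 0}"
  have C1r: "C1_on ?N (plane_map r)"
    unfolding plane_map_def by (intro C1_on_Pair C1_on_divide C1_on_lin_form) auto
  have "open ?N"
    by (intro open_Collect_neq C1_on_imp_continuous_on C1_on_lin_form continuous_on_const)
  with D C1r have openD': "open D'"
    unfolding D'_def by (intro continuous_open_preimage C1_on_imp_continuous_on)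
  have "C1_on D' (plane_map r)"
    using C1r unfolding C1_on_def D'_def by (meson Int_iff continuous_on_subset inf_le1)
  moreover have "C1_on D vel"
    unfolding vel_def using dom D by (intro C1_on_divide C1_on_vel_form) auto
  ultimately have C1u': "C1_on D' u'"
    unfolding u'_def by (rule C1_on_compose) (auto simp: D'_def)
  have "local_C1_solution D' u'"
  proof (rule local_C1_solutionI[OF openD' C1u'])
    fix t' x' d
    assume q: "(t', x') \<in> D'" and d: "(u' has_derivative d) (at (t', x'))"
    obtain t x where tx: "plane_map r (t', x') = (t, x)" by fastforce
    with q have txD: "(t, x) \<in> D" by (auto simp: D'_def)
    with sol obtain e where e: "(u has_derivative e) (at (t, x))" "e (1, u (t, x)) = 0"
      by (rule local_C1_solutionD)
    let ?v = "u (t, x)" and ?L = "lin_form s 3 t x"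
    interpret d: bounded_linear d using d by (rule has_derivative_bounded_linear)
    have P0: "plane_map s (t, x) = (t', x')"
      using bwd[OF q] tx by simp
    have v': "u' (t', x') = vel_form s 1 t x ?v / vel_form s 2 t x ?v"
      by (simp add: u'_def tx vel_def)
    have line: "((\<lambda>h. (t + h, x + h * ?v)) has_vector_derivative (1, ?v)) (at 0)"
      by (auto intro!: has_vector_derivative_Pair derivative_eq_intros
          simp flip: has_real_derivative_iff_has_vector_derivative)
    have "((\<lambda>h. u' (plane_map s (t + h, x + h * ?v))) has_vector_derivative
      d (vel_form s 2 t x ?v / ?L\<^sup>2, vel_form s 1 t x ?v / ?L\<^sup>2)) (at 0)"
      by (rule has_vector_derivative_compose[OF plane_map_along_line_deriv[OF dom(1)[OF txD]]]) (simp add: P0 d)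
    moreover have "((\<lambda>h. u' (plane_map s (t + h, x + h * ?v))) has_vector_derivative 0) (at 0)"
    proof -
      have "((\<lambda>h. u (t + h, x + h * ?v)) has_vector_derivative 0) (at 0)"
        using has_vector_derivative_compose[OF line, of u e] e by simp
      then have u0: "((\<lambda>h. u (t + h, x + h * ?v)) has_real_derivative 0) (at 0)"
        by (simp add: has_real_derivative_iff_has_vector_derivative)
      \<comment> \<open>In \<open>vel_form\<close> the minor with lower index 3 multiplies
        \<open>x - t * v\<close>, which is constant along a line of slope \<open>v\<close>; the
        remaining terms depend on the point only through \<open>u\<close>, which is stationary at
        \<open>h = 0\<close>.\<close>
      have "((\<lambda>h. vel_form s i (t + h) (x + h * ?v) (u (t + h, x + h * ?v))) has_real_derivative 0) (at 0)" for i
        unfolding vel_form_def by (auto intro!: derivative_eq_intros u0)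
      then have "((\<lambda>h. vel (t + h, x + h * ?v)) has_real_derivative 0) (at 0)"
        using dom(2)[OF txD] by (auto intro!: derivative_eq_intros simp: vel_def)
      then have "((\<lambda>h. vel (t + h, x + h * ?v)) has_vector_derivative 0) (at 0)"
        by (simp add: has_real_derivative_iff_has_vector_derivative)
      moreover have "open ((\<lambda>h. (t + h, x + h * ?v)) -` D)"
        by (intro open_vimage D continuous_intros)
      ultimately show ?thesis
        by (rule has_vector_derivative_transform_within_open) (auto simp: txD fwd u'_def)
    qed
    ultimately have "d (vel_form s 2 t x ?v / ?L\<^sup>2, vel_form s 1 t x ?v / ?L\<^sup>2) = 0"
      by (rule vector_derivative_unique_at)
    \<comment> \<open>The velocity of the image line is a nonzero multiple of the characteristic
      direction of \<open>u'\<close>, so the factor can be cancelled.\<close>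
    moreover have "(vel_form s 2 t x ?v / ?L\<^sup>2, vel_form s 1 t x ?v / ?L\<^sup>2)
        = (vel_form s 2 t x ?v / ?L\<^sup>2) *\<^sub>R (1, u' (t', x'))"
      using dom[OF txD] by (simp add: v')
    ultimately show "d (1, u' (t', x')) = 0"
      using dom[OF txD] by (simp only: d.scaleR) simp
  qed
  moreover have "\<Phi> ` graph_over D u = graph_over D' u'"
  proof (intro equalityI subsetI)
    fix y assume "y \<in> \<Phi> ` graph_over D u"
    then obtain t x where "(t, x) \<in> D" "y = \<Phi> (t, x, u (t, x))"
      by (auto simp: graph_over_def)
    then show "y \<in> graph_over D' u'"
      using fwd[of "(t, x)"] by (auto simp: graph_over_def \<Phi> u'_def)
  next
    fix y assume "y \<in> graph_over D' u'"
    then obtain t' x' where y: "(t', x') \<in> D'" "y = (t', x', u' (t', x'))"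
      by (auto simp: graph_over_def)
    obtain t x where tx: "plane_map r (t', x') = (t, x)" by fastforce
    then have "(t, x) \<in> D" using y by (auto simp: D'_def)
    moreover have "y = \<Phi> (t, x, u (t, x))"
      using bwd[OF y(1)] by (simp add: \<Phi>[OF calculation] y tx u'_def)
    ultimately show "y \<in> \<Phi> ` graph_over D u"
      by (auto simp: graph_over_def)
  qed
  ultimately show ?thesis
    unfolding solution_graph_def by blast
qed

lemma projective_form_preserves_solution_graphs:
  assumes "invertible s" "has_projective_form s U \<Phi>"
  shows "preserves_solution_graphs U \<Phi>"
  using assms projective_image_solution_graph
  unfolding preserves_solution_graphs_def solution_graph_def invertible_def by metis

subsection \<open>The derivative of a map that preserves solution graphs\<close>

lemma local_C1_solution_const: "local_C1_solution UNIV (\<lambda>_. c)"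
proof (rule local_C1_solutionI)
  fix t x d
  assume "((\<lambda>_. c) has_derivative d) (at (t :: real, x :: real))"
  from has_derivative_unique[OF this has_derivative_const] show "d (1, c) = 0"
    by simp
qed (auto simp: C1_on_const)

text \<open>A fan of characteristics through \<open>(t0 - 1, x0 - v0)\<close>, placed so that its
  value at \<open>(t0, x0)\<close> is \<open>v0\<close>. There it agrees with the constant solution
  \<open>v0\<close> but has a different tangent plane.\<close>

lemma local_C1_solution_centred:
  "local_C1_solution {q. 0 < fst q - t0 + 1} (\<lambda>q. (snd q - x0 + v0) / (fst q - t0 + 1))"
    (is "local_C1_solution ?D ?u")
  and centred_solution_deriv:
  "0 < t - t0 + 1 \<Longrightarrow>
    ((\<lambda>q. (snd q - x0 + v0) / (fst q - t0 + 1)) has_derivative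
      (\<lambda>h. (snd h - ((x - x0 + v0) / (t - t0 + 1)) * fst h) / (t - t0 + 1))) (at (t, x))"
proof -
  show *: "((\<lambda>q. (snd q - x0 + v0) / (fst q - t0 + 1)) has_derivative
      (\<lambda>h. (snd h - ((x - x0 + v0) / (t - t0 + 1)) * fst h) / (t - t0 + 1))) (at (t, x))"
    if "0 < t - t0 + 1" for t x
    by (rule has_derivative_eq_rhs, (rule derivative_intros)+)
      (use that in \<open>auto simp: fun_eq_iff field_simps\<close>)
  show "local_C1_solution ?D ?u"
  proof (rule local_C1_solutionI)
    show "open ?D" by (intro open_Collect_less continuous_intros)
    show "C1_on ?D ?u"
      by (intro C1_on_divide C1_on_add C1_on_diff C1_on_fst C1_on_snd C1_on_const) auto
    fix t x d assume "(t, x) \<in> ?D" and d: "(?u has_derivative d) (at (t, x))"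
    then have "0 < t - t0 + 1" by simp
    then show "d (1, ?u (t, x)) = 0"
      unfolding has_derivative_unique[OF d *[OF \<open>0 < t - t0 + 1\<close>]] by simp
  qed
qed

text \<open>Trims a test solution so that its graph lies in \<open>U\<close>, as
  \<open>preserves_solution_graphs\<close> demands.\<close>

lemma local_C1_solution_restrict:
  assumes "local_C1_solution D u" "open U"
  shows "local_C1_solution {q \<in> D. (fst q, snd q, u q) \<in> U} u"
proof -
  have D: "open D" "C1_on D u" using assms by (auto simp: local_C1_solution_def)
  have "continuous_on D (\<lambda>q. (fst q, snd q, u q))"
    by (intro continuous_intros C1_on_imp_continuous_on D)
  then have "open (D \<inter> (\<lambda>q. (fst q, snd q, u q)) -` U)"
    using D assms(2) by (rule_tac continuous_open_preimage)
  moreover have "D \<inter> (\<lambda>q. (fst q, snd q, u q)) -` U = {q \<in> D. (fst q, snd q, u q) \<in> U}" by auto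
  ultimately show ?thesis
    using assms(1) unfolding local_C1_solution_def C1_on_def
    by (auto intro: continuous_on_subset)
qed

text \<open>The domain of a solution need not be connected, so constant solutions over two disjoint
  neighbourhoods form a single solution, whose image has to be a graph again.\<close>

lemma solution_graphs_separate_fibres:
  assumes U: "open U" "inj_on \<Phi> U" and pres: "preserves_solution_graphs U \<Phi>"
    and p: "(t, x, v) \<in> U" "\<Phi> (t, x, v) = (a, b, c)"
    and p': "(t', x', v') \<in> U" "\<Phi> (t', x', v') = (a, b, c')"
  shows "(t', x') = (t, x)"
proof (rule ccontr)
  assume "(t', x') \<noteq> (t, x)"
  then obtain A B where AB: "open A" "open B" "(t, x) \<in> A" "(t', x') \<in> B" "A \<inter> B = {}"
    by (metis hausdorff)
  define u where "u q = (if q \<in> A then v else v')" for q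
  have "local_C1_solution (A \<union> B) u"
  proof (rule local_C1_solutionI)
    have *: "(u has_derivative (\<lambda>_. 0)) (at q)" if "q \<in> A \<union> B" for q
    proof (cases "q \<in> A")
      case True
      show ?thesis
        by (rule has_derivative_transform_within_open[OF has_derivative_const[of v] AB(1) True])
          (simp add: u_def)
    next
      case False
      with that have "q \<in> B" by auto
      show ?thesis
        by (rule has_derivative_transform_within_open[OF has_derivative_const[of v'] AB(2) \<open>q \<in> B\<close>])
          (use AB in \<open>auto simp: u_def\<close>)
    qed
    then show "C1_on (A \<union> B) u"
      by (intro C1_onI[where f' = "\<lambda>_. 0"]) (auto simp: zero_blinfun.rep_eq)
    fix t x d assume tx: "(t, x) \<in> A \<union> B" and d: "(u has_derivative d) (at (t, x))"
    from has_derivative_unique[OF d *[OF tx]] show "d (1, u (t, x)) = 0" by simp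
  qed (use AB in auto)
  from local_C1_solution_restrict[OF this U(1)]
  have sol: "solution_graph (graph_over {q \<in> A \<union> B. (fst q, snd q, u q) \<in> U} u)" (is "solution_graph ?G")
    by (auto simp: solution_graph_def)
  have "?G \<subseteq> U" by (auto simp: graph_over_def)
  with sol pres have "solution_graph (\<Phi> ` ?G)"
    unfolding preserves_solution_graphs_def by blast
  then obtain D' u' where G': "\<Phi> ` ?G = graph_over D' u'"
    unfolding solution_graph_def by blast
  have u: "u (t, x) = v" "u (t', x') = v'" using AB by (auto simp: u_def)
  have "(t, x, v) \<in> ?G" "(t', x', v') \<in> ?G"
    unfolding graph_over_def using AB p p' u by force+
  then have "(a, b, c) \<in> graph_over D' u'" "(a, b, c') \<in> graph_over D' u'"
    unfolding G'[symmetric] p(2)[symmetric] p'(2)[symmetric] by auto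
  then have "\<Phi> (t, x, v) = \<Phi> (t', x', v')"
    by (auto simp: p p' graph_over_def)
  with inj_onD[OF U(2) _ p(1) p'(1)] \<open>(t', x') \<noteq> (t, x)\<close> show False by simp
qed

text \<open>The image surface is again the graph of a solution, so \<open>(1, w, 0)\<close> is
  tangent to it. The inverse map carries a curve in this surface with that velocity back into the
  graph of \<open>u\<close>, whose tangent plane therefore contains
  \<open>\<psi> (1, w, 0)\<close>.\<close>

lemma inverse_deriv_tangent_to_graph:
  assumes inj: "inj_on \<Phi> U" and G: "graph_over D u \<subseteq> U"
    and img: "solution_graph (\<Phi> ` graph_over D u)"
    and p: "(t, x) \<in> D" "\<Phi> (t, x, u (t, x)) = (a, b, w)"
    and \<psi>: "(the_inv_into U \<Phi> has_derivative \<psi>) (at (a, b, w))"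
    and e: "(u has_derivative e) (at (t, x))"
    and h: "\<psi> (1, w, 0) = (h1, h2, h3)"
  shows "h3 = e (h1, h2)"
proof -
  define \<Psi> where "\<Psi> = the_inv_into U \<Phi>"
  have \<Psi>: "\<Psi> (\<Phi> q) = q" if "q \<in> U" for q
    unfolding \<Psi>_def by (rule the_inv_into_f_f[OF inj that])
  obtain D' u' where sol: "local_C1_solution D' u'" and G': "\<Phi> ` graph_over D u = graph_over D' u'"
    using img unfolding solution_graph_def by blast
  have pG: "(t, x, u (t, x)) \<in> graph_over D u" using p by (auto simp: graph_over_def)
  then have "(a, b, w) \<in> graph_over D' u'"
    unfolding G'[symmetric] p(2)[symmetric] by blast
  then have ab: "(a, b) \<in> D'" "u' (a, b) = w" by (auto simp: graph_over_def)
  obtain d where d: "(u' has_derivative d) (at (a, b))" "d (1, w) = 0"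
    using local_C1_solutionD[OF sol ab(1)] ab(2) by metis
  define l where "l s = (a + s, b + s * w)" for s
  define \<gamma> where "\<gamma> s = (a + s, b + s * w, u' (l s))" for s
  have "(l has_vector_derivative (1, w)) (at 0)"
    unfolding l_def by (auto intro!: has_vector_derivative_Pair derivative_eq_intros
          simp flip: has_real_derivative_iff_has_vector_derivative)
  from has_vector_derivative_compose[OF this, of u' d] d
  have "((\<lambda>s. u' (l s)) has_vector_derivative 0) (at 0)" by (simp add: l_def)
  then have "(\<gamma> has_vector_derivative (1, w, 0)) (at 0)"
    unfolding \<gamma>_def by (auto intro!: has_vector_derivative_Pair derivative_eq_intros
          simp flip: has_real_derivative_iff_has_vector_derivative)
  from has_vector_derivative_compose[OF this, of \<Psi> \<psi>] \<psi>
  have \<delta>: "((\<lambda>s. \<Psi> (\<gamma> s)) has_vector_derivative (h1, h2, h3)) (at 0)"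
    by (simp add: \<gamma>_def l_def ab \<Psi>_def h)
  have \<delta>0: "\<Psi> (\<gamma> 0) = (t, x, u (t, x))"
    using \<Psi> pG G p by (metis \<gamma>_def l_def ab(2) add_0_right mult_zero_left subsetD)
  have on_graph: "snd (snd (\<Psi> (\<gamma> s))) = u (fst (\<Psi> (\<gamma> s)), fst (snd (\<Psi> (\<gamma> s))))" if "l s \<in> D'" for s
  proof -
    have "\<gamma> s \<in> \<Phi> ` graph_over D u"
      using that unfolding G' by (auto simp: graph_over_def \<gamma>_def l_def)
    then obtain q where "q \<in> graph_over D u" "\<gamma> s = \<Phi> q" by blast
    then show ?thesis
      using G by (subst (1 2 3) \<open>\<gamma> s = \<Phi> q\<close>) (auto simp: \<Psi> subset_iff graph_over_def)
  qed
  have lin: "bounded_linear (\<lambda>p :: real \<times> real \<times> real. snd (snd p))"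
    "bounded_linear (\<lambda>p :: real \<times> real \<times> real. (fst p, fst (snd p)))"
    by (intro bounded_linear_intros)+
  have "((\<lambda>s. snd (snd (\<Psi> (\<gamma> s)))) has_vector_derivative h3) (at 0)"
    using bounded_linear.has_vector_derivative[OF lin(1) \<delta>] by simp
  moreover have "((\<lambda>s. u (fst (\<Psi> (\<gamma> s)), fst (snd (\<Psi> (\<gamma> s))))) has_vector_derivative e (h1, h2)) (at 0)"
    using has_vector_derivative_compose[OF bounded_linear.has_vector_derivative[OF lin(2) \<delta>], of u e] e
    by (simp add: \<delta>0)
  then have "((\<lambda>s. snd (snd (\<Psi> (\<gamma> s)))) has_vector_derivative e (h1, h2)) (at 0)"
  proof (rule has_vector_derivative_transform_within_open)
    show "open (l -` D')"
      unfolding l_def using sol by (intro open_vimage continuous_intros) (auto simp: local_C1_solution_def)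
    show "0 \<in> l -` D'" using ab by (simp add: l_def)
  qed (simp add: on_graph)
  ultimately show ?thesis by (rule vector_derivative_unique_at)
qed

text \<open>The derivative of the inverse maps characteristic directions to characteristic
  directions and fibre directions to fibre directions. Inverting these two facts gives the shape of
  the derivative of \<open>\<Phi>\<close>; its invertibility gives the three inequalities.\<close>

lemma contact_derivative:
  assumes U: "open U" and V: "open V" and diff: "C1_diffeomorphism U V \<Phi>"
    and pres: "preserves_solution_graphs U \<Phi>"
    and p: "(t, x, v) \<in> U" "\<Phi> (t, x, v) = (a, b, w)"
  obtains T1 T2 Y1 Y2 w2 w3 where
    "(\<Phi> has_derivative (\<lambda>h. (T1 * fst h + T2 * fst (snd h), Y1 * fst h + Y2 * fst (snd h),
        w2 * (fst (snd h) - v * fst h) + w3 * snd (snd h)))) (at (t, x, v))"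
    "Y1 + v * Y2 = w * (T1 + v * T2)" "T1 + v * T2 \<noteq> 0" "Y2 - w * T2 \<noteq> 0" "w3 \<noteq> 0"
proof -
  define \<Psi> where "\<Psi> = the_inv_into U \<Phi>"
  have bij: "bij_betw \<Phi> U V" and inj: "inj_on \<Phi> U"
    using diff by (auto simp: C1_diffeomorphism_def bij_betw_def)
  have \<Psi>: "\<Psi> (\<Phi> q) = q" if "q \<in> U" for q
    unfolding \<Psi>_def by (rule the_inv_into_f_f[OF inj that])
  have \<Psi>V: "\<Psi> q \<in> U" "\<Phi> (\<Psi> q) = q" if "q \<in> V" for q
    using bij that unfolding \<Psi>_def
    by (metis bij_betwE bij_betw_the_inv_into) (metis bij f_the_inv_into_f_bij_betw that)
  have abw: "(a, b, w) \<in> V" using bij p by (metis bij_betwE)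
  obtain \<phi> where \<phi>: "(\<Phi> has_derivative \<phi>) (at (t, x, v))"
    using diff p unfolding C1_diffeomorphism_def C1_on_def by blast
  obtain \<psi> where \<psi>: "(\<Psi> has_derivative \<psi>) (at (a, b, w))"
    using diff abw unfolding C1_diffeomorphism_def C1_on_def \<Psi>_def by blast
  interpret \<phi>: bounded_linear \<phi> using \<phi> by (rule has_derivative_bounded_linear)
  interpret \<psi>: bounded_linear \<psi> using \<psi> by (rule has_derivative_bounded_linear)
  have "((\<lambda>q. \<Psi> (\<Phi> q)) has_derivative (\<lambda>h. \<psi> (\<phi> h))) (at (t, x, v))"
    using has_derivative_compose[OF \<phi>, of \<Psi> \<psi>] \<psi> by (simp add: p)
  then have "((\<lambda>q. q) has_derivative (\<lambda>h. \<psi> (\<phi> h))) (at (t, x, v))"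
    by (rule has_derivative_transform_within_open[OF _ U p(1)]) (simp add: \<Psi>)
  from has_derivative_unique[OF this has_derivative_ident]
  have \<psi>\<phi>: "\<psi> (\<phi> h) = h" for h by metis
  have "((\<lambda>q. \<Phi> (\<Psi> q)) has_derivative (\<lambda>h. \<phi> (\<psi> h))) (at (a, b, w))"
    using has_derivative_compose[OF \<psi>, of \<Phi> \<phi>] \<phi> \<Psi>[OF p(1)] by (simp add: p)
  then have "((\<lambda>q. q) has_derivative (\<lambda>h. \<phi> (\<psi> h))) (at (a, b, w))"
    by (rule has_derivative_transform_within_open[OF _ V abw]) (simp add: \<Psi>V)
  from has_derivative_unique[OF this has_derivative_ident]
  have \<phi>\<psi>: "\<phi> (\<psi> h) = h" for h by metis

  obtain m where m: "\<psi> (1, w, 0) = m *\<^sub>R (1, v, 0)"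
  proof -
    obtain h1 h2 h3 where h: "\<psi> (1, w, 0) = (h1, h2, h3)" by (metis prod.exhaust)
    have tangent: "h3 = e (h1, h2)"
      if u: "local_C1_solution D u" "(t, x) \<in> D" "u (t, x) = v" "(u has_derivative e) (at (t, x))" for D u e
    proof -
      let ?D = "{q \<in> D. (fst q, snd q, u q) \<in> U}"
      have sub: "graph_over ?D u \<subseteq> U" by (auto simp: graph_over_def)
      have "solution_graph (\<Phi> ` graph_over ?D u)"
        using pres sub local_C1_solution_restrict[OF u(1) U]
        unfolding preserves_solution_graphs_def solution_graph_def by blast
      moreover have "(t, x) \<in> ?D" "\<Phi> (t, x, u (t, x)) = (a, b, w)"
        using p u by auto
      ultimately show ?thesis
        by (rule inverse_deriv_tangent_to_graph[where e = e and \<psi> = \<psi>, OF inj sub _ _ _ \<psi>[unfolded \<Psi>_def] u(4) h])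
    qed
    \<comment> \<open>The tangent planes of the constant solution and of the centred one meet
      exactly in the line spanned by \<open>(1, v, 0)\<close>.\<close>
    have "h3 = 0"
      using tangent[OF local_C1_solution_const[of v] _ _ has_derivative_const] by simp
    moreover have "h3 = h2 - v * h1"
      using tangent[OF local_C1_solution_centred _ _ centred_solution_deriv, of t x v] by simp
    ultimately show thesis
      using that[of h1] h by simp
  qed
  \<comment> \<open>Points over \<open>(a, b)\<close> have preimages over the single point
    \<open>(t, x)\<close>, so the first two components of the inverse are constant along this
    fibre.\<close>
  obtain k where k: "\<psi> (0, 0, 1) = k *\<^sub>R (0, 0, 1)"
  proof -
    have "((\<lambda>s. (a, b, w + s)) has_vector_derivative (0, 0, 1)) (at 0)"
      by (auto intro!: has_vector_derivative_Pair derivative_eq_intros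
          simp flip: has_real_derivative_iff_has_vector_derivative)
    from has_vector_derivative_compose[OF this, of \<Psi> \<psi>] \<psi>
    have d: "((\<lambda>s. \<Psi> (a, b, w + s)) has_vector_derivative \<psi> (0, 0, 1)) (at 0)" by simp
    have lin: "bounded_linear (\<lambda>p :: real \<times> real \<times> real. (fst p, fst (snd p)))"
      by (intro bounded_linear_intros)
    have "((\<lambda>s. (t, x)) has_vector_derivative (fst (\<psi> (0, 0, 1)), fst (snd (\<psi> (0, 0, 1))))) (at 0)"
    proof (rule has_vector_derivative_transform_within_open[OF bounded_linear.has_vector_derivative[OF lin d]])
      show "open ((\<lambda>s. (a, b, w + s)) -` V)"
        by (intro open_vimage V continuous_intros)
      show "0 \<in> (\<lambda>s. (a, b, w + s)) -` V" using abw by simp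
      fix s assume "s \<in> (\<lambda>s. (a, b, w + s)) -` V"
      then have s: "\<Psi> (a, b, w + s) \<in> U" "\<Phi> (\<Psi> (a, b, w + s)) = (a, b, w + s)"
        using \<Psi>V by auto
      obtain t' x' v' where q: "\<Psi> (a, b, w + s) = (t', x', v')" by (metis prod.exhaust)
      from solution_graphs_separate_fibres[OF U inj pres p s[unfolded q]]
      show "(fst (\<Psi> (a, b, w + s)), fst (snd (\<Psi> (a, b, w + s)))) = (t, x)"
        by (simp add: q)
    qed
    from vector_derivative_unique_at[OF this has_vector_derivative_const]
    have "fst (\<psi> (0, 0, 1)) = 0 \<and> fst (snd (\<psi> (0, 0, 1))) = 0" by (simp add: zero_prod_def)
    then show thesis
      using that[of "snd (snd (\<psi> (0, 0, 1)))"] by (simp add: prod_eq_iff)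
  qed
  have m': "(1, w, 0) = m *\<^sub>R \<phi> (1, v, 0)"
    using \<phi>\<psi>[of "(1, w, 0)"] by (simp only: m \<phi>.scaleR)
  have k': "(0, 0, 1) = k *\<^sub>R \<phi> (0, 0, 1)"
    using \<phi>\<psi>[of "(0, 0, 1)"] by (simp only: k \<phi>.scaleR)
  obtain T1 Y1 w1 where c1: "\<phi> (1, 0, 0) = (T1, Y1, w1)" by (metis prod.exhaust)
  obtain T2 Y2 w2 where c2: "\<phi> (0, 1, 0) = (T2, Y2, w2)" by (metis prod.exhaust)
  obtain w3 where c3: "\<phi> (0, 0, 1) = (0, 0, w3)" "w3 \<noteq> 0"
  proof -
    obtain T3 Y3 w3 where c: "\<phi> (0, 0, 1) = (T3, Y3, w3)" by (metis prod.exhaust)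
    from k' have "k * T3 = 0" "k * Y3 = 0" "k * w3 = 1" by (simp_all add: c)
    then have "T3 = 0" "Y3 = 0" "w3 \<noteq> 0" by auto
    then show thesis using that c by simp
  qed
  have \<phi>_eq: "\<phi> h = (T1 * fst h + T2 * fst (snd h), Y1 * fst h + Y2 * fst (snd h),
      w1 * fst h + w2 * fst (snd h) + w3 * snd (snd h))" for h
  proof -
    have "h = fst h *\<^sub>R (1, 0, 0) + fst (snd h) *\<^sub>R (0, 1, 0) + snd (snd h) *\<^sub>R (0, 0, 1)"
      by (simp add: prod_eq_iff)
    then have "\<phi> h = fst h *\<^sub>R (T1, Y1, w1) + fst (snd h) *\<^sub>R (T2, Y2, w2) + snd (snd h) *\<^sub>R (0, 0, w3)"
      by (metis c1 c2 c3(1) \<phi>.add \<phi>.scaleR)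
    then show ?thesis by (simp add: algebra_simps)
  qed
  have e: "m * (T1 + T2 * v) = 1" "m * (Y1 + Y2 * v) = w" "m * (w1 + w2 * v) = 0"
    using m' by (simp_all add: \<phi>_eq)
  then have nz: "m \<noteq> 0" "T1 + v * T2 \<noteq> 0" by (auto simp: mult.commute)
  have "Y1 + v * Y2 = w * (T1 + v * T2)"
    using e(1,2) nz by (metis mult.assoc mult.commute mult_cancel_left mult.right_neutral)
  moreover have w1: "w1 = - (v * w2)" using e(3) nz by (simp add: mult.commute eq_neg_iff_add_eq_0)
  moreover have "Y2 - w * T2 \<noteq> 0"
  proof
    assume "Y2 - w * T2 = 0"
    then have Y: "Y2 = w * T2" "Y1 = w * T1" using calculation(1) by (auto simp: algebra_simps)
    \<comment> \<open>If the expression vanished, \<open>T\<close> and \<open>Y\<close> would have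
      proportional gradients. Both kill \<open>(T2, - T1)\<close>, and \<open>c\<close> is chosen to
      make the third component vanish as well, which produces a kernel vector of
      \<open>\<phi>\<close>.\<close>
    define c where "c = (w1 * T2 - w2 * T1) / w3"
    have "\<phi> (T2, - T1, - c) = 0"
      using c3(2) by (simp add: \<phi>_eq Y c_def zero_prod_def)
    then have "(T2, - T1, - c) = 0" by (metis \<psi>\<phi> \<psi>.zero)
    with nz(2) show False by (simp add: zero_prod_def)
  qed
  moreover have "\<phi> = (\<lambda>h. (T1 * fst h + T2 * fst (snd h), Y1 * fst h + Y2 * fst (snd h),
        w2 * (fst (snd h) - v * fst h) + w3 * snd (snd h)))"
    by (auto simp: fun_eq_iff \<phi>_eq w1 algebra_simps)
  ultimately show thesis
    using that[of T1 T2 Y1 Y2 w2 w3] \<phi> nz c3(2) by simp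
qed

subsection \<open>Functions that are affine on lines\<close>

text \<open>Being affine in each variable leaves only
  \<open>a + b * y1 + c * y2 + d * y1 * y2\<close>. On the diagonal this is quadratic with leading
  coefficient \<open>d\<close>, so affinity there forces \<open>d = 0\<close>. The argument uses
  values alone, without derivatives.\<close>

lemma bilinear_affine_on_diagonal:
  fixes g :: "real \<Rightarrow> real \<Rightarrow> real"
  assumes "\<eta> > 0"
    and fst: "\<And>y2. \<bar>y2\<bar> \<le> \<eta> \<Longrightarrow> \<exists>P Q. \<forall>y1. \<bar>y1\<bar> \<le> \<eta> \<longrightarrow> g y1 y2 = P + Q * y1"
    and snd: "\<And>y1. \<bar>y1\<bar> \<le> \<eta> \<Longrightarrow> \<exists>P Q. \<forall>y2. \<bar>y2\<bar> \<le> \<eta> \<longrightarrow> g y1 y2 = P + Q * y2"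
    and diag: "\<exists>P Q. \<forall>y. \<bar>y\<bar> \<le> \<eta> \<longrightarrow> g y y = P + Q * y"
  shows "\<exists>a b c. \<forall>y1 y2. \<bar>y1\<bar> \<le> \<eta> \<longrightarrow> \<bar>y2\<bar> \<le> \<eta> \<longrightarrow> g y1 y2 = a + b * y1 + c * y2"
proof -
  \<comment> \<open>An affine function is determined by its values at \<open>0\<close> and
    \<open>\<eta>\<close>; this replaces the unknown \<open>P\<close> and \<open>Q\<close> by
    explicit expressions.\<close>
  have *: "f y = f 0 + (f \<eta> - f 0) / \<eta> * y"
    if "\<exists>P Q. \<forall>y. \<bar>y\<bar> \<le> \<eta> \<longrightarrow> f y = P + Q * y" "\<bar>y\<bar> \<le> \<eta>" for f :: "real \<Rightarrow> real" and y
  proof -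
    from that(1) obtain P Q where PQ: "\<And>y. \<bar>y\<bar> \<le> \<eta> \<Longrightarrow> f y = P + Q * y" by blast
    show ?thesis
      using PQ[of 0] PQ[of \<eta>] PQ[OF that(2)] \<open>\<eta> > 0\<close> by simp
  qed
  define a b c d where "a = g 0 0" and "b = (g \<eta> 0 - g 0 0) / \<eta>" and "c = (g 0 \<eta> - g 0 0) / \<eta>"
    and "d = ((g \<eta> \<eta> - g \<eta> 0) / \<eta> - c) / \<eta>"
  have g: "g y1 y2 = a + b * y1 + c * y2 + d * y1 * y2" if "\<bar>y1\<bar> \<le> \<eta>" "\<bar>y2\<bar> \<le> \<eta>" for y1 y2
  proof -
    have "g \<eta> 0 = a + b * \<eta>" "(g \<eta> \<eta> - g \<eta> 0) / \<eta> = c + d * \<eta>"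
      using \<open>\<eta> > 0\<close> by (simp_all add: a_def b_def d_def)
    moreover have "g \<eta> y2 = g \<eta> 0 + (g \<eta> \<eta> - g \<eta> 0) / \<eta> * y2"
      using *[OF snd that(2), of \<eta>] \<open>\<eta> > 0\<close> by simp
    ultimately have "g \<eta> y2 = a + b * \<eta> + (c + d * \<eta>) * y2"
      by (simp only:)
    moreover have "g 0 y2 = a + c * y2"
      using *[OF snd that(2), of 0] \<open>\<eta> > 0\<close> by (simp add: a_def c_def)
    ultimately have "g y1 y2 = a + c * y2 + (b * \<eta> + d * \<eta> * y2) / \<eta> * y1"
      using *[OF fst[OF that(2)] that(1)] by (simp add: algebra_simps)
    also have "(b * \<eta> + d * \<eta> * y2) / \<eta> = b + d * y2"
      using \<open>\<eta> > 0\<close> by (simp add: field_simps)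
    finally show ?thesis by (simp add: algebra_simps)
  qed
  have "g (\<eta> / 2) (\<eta> / 2) = g 0 0 + (g \<eta> \<eta> - g 0 0) / \<eta> * (\<eta> / 2)"
    using *[OF diag, of "\<eta> / 2"] \<open>\<eta> > 0\<close> by simp
  then have "a + b * (\<eta> / 2) + c * (\<eta> / 2) + d * (\<eta> / 2) * (\<eta> / 2) = a + (b * \<eta> + c * \<eta> + d * \<eta> * \<eta>) / 2"
    using g[of "\<eta> / 2" "\<eta> / 2"] g[of 0 0] g[of \<eta> \<eta>] \<open>\<eta> > 0\<close> by simp
  then have "d * \<eta> * \<eta> = 0" by (simp add: field_simps)
  then have "d = 0" using \<open>\<eta> > 0\<close> by simp
  with g show ?thesis by auto
qed

text \<open>Three slopes suffice: lines of slopes \<open>v0 - \<eta>\<close> and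
  \<open>v0 + \<eta>\<close> serve as oblique coordinate axes, and the diagonal of these coordinates
  is the line of slope \<open>v0\<close>.\<close>

lemma affine_on_lines_imp_affine:
  fixes f :: "real \<Rightarrow> real \<Rightarrow> real"
  assumes "\<epsilon> > 0"
    and lines: "\<And>c v. \<bar>c\<bar> < \<epsilon> \<Longrightarrow> \<bar>v - v0\<bar> < \<epsilon> \<Longrightarrow>
      \<exists>P Q. \<forall>\<tau>. \<bar>\<tau>\<bar> < \<epsilon> \<longrightarrow> f (t0 + \<tau>) (x0 + c + v * \<tau>) = P + Q * \<tau>"
  obtains \<alpha> \<beta> \<gamma> \<rho> where "\<rho> > 0"
    "\<And>t x. \<bar>t - t0\<bar> < \<rho> \<Longrightarrow> \<bar>x - x0\<bar> < \<rho> \<Longrightarrow> f t x = \<alpha> * t + \<beta> * x + \<gamma>"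
proof -
  \<comment> \<open>The bound by \<open>\<epsilon> / 4\<close> keeps the time \<open>y1 + y2\<close>
    and the slopes in range; the bound by \<open>1 / 2\<close> keeps the offsets
    \<open>2 * \<eta> * y\<close> of the coordinate lines below \<open>\<epsilon>\<close>.\<close>
  define \<eta> where "\<eta> = min (\<epsilon> / 4) (1 / 2)"
  have \<eta>: "\<eta> > 0" "4 * \<eta> \<le> \<epsilon>" "\<eta> \<le> 1 / 2" using \<open>\<epsilon> > 0\<close> by (auto simp: \<eta>_def)
  define g where "g y1 y2 = f (t0 + (y1 + y2)) (x0 + ((v0 - \<eta>) * y1 + (v0 + \<eta>) * y2))" for y1 y2
  have small: "\<bar>2 * \<eta> * y\<bar> < \<epsilon>" if "\<bar>y\<bar> \<le> \<eta>" for y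
  proof -
    have "\<bar>2 * \<eta> * y\<bar> = 2 * (\<eta> * \<bar>y\<bar>)" using \<eta> by (simp add: abs_mult)
    also have "\<dots> \<le> 2 * (1 / 2 * \<eta>)" using that \<eta> by (intro mult_left_mono mult_mono) auto
    finally show ?thesis using \<eta> by simp
  qed
  have "\<exists>a b c. \<forall>y1 y2. \<bar>y1\<bar> \<le> \<eta> \<longrightarrow> \<bar>y2\<bar> \<le> \<eta> \<longrightarrow> g y1 y2 = a + b * y1 + c * y2"
  proof (rule bilinear_affine_on_diagonal[OF \<eta>(1)])
    fix y2 assume y2: "\<bar>y2\<bar> \<le> \<eta>"
    obtain P Q where PQ: "\<And>\<tau>. \<bar>\<tau>\<bar> < \<epsilon> \<Longrightarrow> f (t0 + \<tau>) (x0 + 2 * \<eta> * y2 + (v0 - \<eta>) * \<tau>) = P + Q * \<tau>"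
      using lines[of "2 * \<eta> * y2" "v0 - \<eta>"] small[OF y2] \<eta> by auto
    have "g y1 y2 = (P + Q * y2) + Q * y1" if "\<bar>y1\<bar> \<le> \<eta>" for y1
      using PQ[of "y1 + y2"] that y2 \<eta> by (simp add: g_def algebra_simps)
    then show "\<exists>P Q. \<forall>y1. \<bar>y1\<bar> \<le> \<eta> \<longrightarrow> g y1 y2 = P + Q * y1" by blast
  next
    fix y1 assume y1: "\<bar>y1\<bar> \<le> \<eta>"
    obtain P Q where PQ: "\<And>\<tau>. \<bar>\<tau>\<bar> < \<epsilon> \<Longrightarrow> f (t0 + \<tau>) (x0 + - (2 * \<eta> * y1) + (v0 + \<eta>) * \<tau>) = P + Q * \<tau>"
      using lines[of "- (2 * \<eta> * y1)" "v0 + \<eta>"] small[OF y1] \<eta> by auto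
    have "g y1 y2 = (P + Q * y1) + Q * y2" if "\<bar>y2\<bar> \<le> \<eta>" for y2
      using PQ[of "y1 + y2"] that y1 \<eta> by (simp add: g_def algebra_simps)
    then show "\<exists>P Q. \<forall>y2. \<bar>y2\<bar> \<le> \<eta> \<longrightarrow> g y1 y2 = P + Q * y2" by blast
  next
    obtain P Q where PQ: "\<And>\<tau>. \<bar>\<tau>\<bar> < \<epsilon> \<Longrightarrow> f (t0 + \<tau>) (x0 + 0 + v0 * \<tau>) = P + Q * \<tau>"
      using lines[of 0 v0] \<open>\<epsilon> > 0\<close> by auto
    have "g y y = P + (2 * Q) * y" if "\<bar>y\<bar> \<le> \<eta>" for y
      using PQ[of "2 * y"] that \<eta> by (simp add: g_def algebra_simps)
    then show "\<exists>P Q. \<forall>y. \<bar>y\<bar> \<le> \<eta> \<longrightarrow> g y y = P + Q * y" by blast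
  qed
  then obtain a b c where g: "\<And>y1 y2. \<bar>y1\<bar> \<le> \<eta> \<Longrightarrow> \<bar>y2\<bar> \<le> \<eta> \<Longrightarrow> g y1 y2 = a + b * y1 + c * y2"
    by blast
  define K where "K = 1 + (1 + \<bar>v0\<bar>) / \<eta>"
  have K: "K > 0" unfolding K_def using \<eta> by (intro add_pos_nonneg) auto
  show thesis
  proof
    show "\<eta> / K > 0" using \<eta> K by simp
    fix t x assume tx: "\<bar>t - t0\<bar> < \<eta> / K" "\<bar>x - x0\<bar> < \<eta> / K"
    \<comment> \<open>Inverts the oblique coordinates: \<open>\<sigma>\<close> is
      \<open>y2 - y1\<close>, while \<open>t - t0\<close> is \<open>y1 + y2\<close>. The constant
      \<open>K\<close> bounds the growth under this inversion.\<close>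
    define \<sigma> where "\<sigma> = (x - x0 - v0 * (t - t0)) / \<eta>"
    have "\<bar>x - x0 - v0 * (t - t0)\<bar> \<le> \<bar>x - x0\<bar> + \<bar>v0\<bar> * \<bar>t - t0\<bar>"
      by (metis abs_mult abs_triangle_ineq4)
    also have "\<dots> \<le> \<eta> / K + \<bar>v0\<bar> * (\<eta> / K)"
      using tx by (intro add_mono mult_left_mono) auto
    finally have "\<bar>\<sigma>\<bar> \<le> (\<eta> / K + \<bar>v0\<bar> * (\<eta> / K)) / \<eta>"
      unfolding \<sigma>_def using \<eta> by (simp add: abs_divide divide_right_mono)
    also have "\<dots> = \<eta> / K * ((1 + \<bar>v0\<bar>) / \<eta>)"
      by (simp add: algebra_simps add_divide_distrib)
    finally have "\<bar>\<sigma>\<bar> + \<bar>t - t0\<bar> \<le> \<eta> / K * ((1 + \<bar>v0\<bar>) / \<eta>) + \<eta> / K"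
      using tx by simp
    also have "\<dots> = \<eta> / K * K"
      unfolding K_def by (simp only: distrib_left mult_1_right add.commute)
    finally have "\<bar>\<sigma>\<bar> + \<bar>t - t0\<bar> \<le> \<eta>" using K by simp
    then have y: "\<bar>(t - t0 - \<sigma>) / 2\<bar> \<le> \<eta>" "\<bar>(t - t0 + \<sigma>) / 2\<bar> \<le> \<eta>" by auto
    have "\<eta> * \<sigma> = x - x0 - v0 * (t - t0)" using \<eta> by (simp add: \<sigma>_def)
    then have "g ((t - t0 - \<sigma>) / 2) ((t - t0 + \<sigma>) / 2) = f t x"
      unfolding g_def by (intro arg_cong2[where f = f]) (auto simp: field_simps)
    with g[OF y] have "f t x = a + (b + c) / 2 * (t - t0) + (c - b) / 2 * \<sigma>"
      by (simp add: field_simps)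
    also have "\<dots> = ((b + c) / 2 - (c - b) / (2 * \<eta>) * v0) * t + (c - b) / (2 * \<eta>) * x
        + (a - (b + c) / 2 * t0 - (c - b) / (2 * \<eta>) * (x0 - v0 * t0))"
      using \<eta>(1) by (simp add: \<sigma>_def field_simps)
    finally show "f t x = ((b + c) / 2 - (c - b) / (2 * \<eta>) * v0) * t + (c - b) / (2 * \<eta>) * x
        + (a - (b + c) / 2 * t0 - (c - b) / (2 * \<eta>) * (x0 - v0 * t0))" .
  qed
qed

subsection \<open>Maps that respect characteristics and fibres\<close>

lemma has_real_derivative_along_curve:
  fixes f :: "real \<times> real \<times> real \<Rightarrow> real"
  assumes "(f has_derivative (\<lambda>h. A * fst h + B * fst (snd h) + C * snd (snd h))) (at (g1 s, g2 s, g3 s))"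
    and "(g1 has_real_derivative d1) (at s)" "(g2 has_real_derivative d2) (at s)" "(g3 has_real_derivative d3) (at s)"
  shows "((\<lambda>s. f (g1 s, g2 s, g3 s)) has_real_derivative A * d1 + B * d2 + C * d3) (at s)"
proof -
  have "((\<lambda>s. (g1 s, g2 s, g3 s)) has_vector_derivative (d1, d2, d3)) (at s)"
    using assms(2-) by (auto intro!: has_vector_derivative_Pair simp: has_real_derivative_iff_has_vector_derivative)
  from has_vector_derivative_compose[OF this assms(1)] show ?thesis
    by (simp add: has_real_derivative_iff_has_vector_derivative)
qed

lemma has_real_derivative_unique_near:
  fixes f g :: "real \<Rightarrow> real"
  assumes "(f has_real_derivative a) (at s)" "(g has_real_derivative b) (at s)"
    and "e > 0" "\<And>s'. \<bar>s' - s\<bar> < e \<Longrightarrow> f s' = g s'"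
  shows "a = b"
proof -
  have "(g has_real_derivative a) (at s)"
    by (rule has_field_derivative_transform_within_open[OF assms(1), of "ball s e"])
      (use assms(3,4) in \<open>auto simp: dist_real_def abs_minus_commute\<close>)
  with assms(2) show ?thesis by (rule DERIV_unique[rotated])
qed

lemma constant_of_zero_derivative:
  fixes f :: "real \<Rightarrow> real"
  assumes "\<And>s. \<bar>s - c\<bar> < e \<Longrightarrow> (f has_real_derivative 0) (at s)" "\<bar>a - c\<bar> < e" "\<bar>b - c\<bar> < e"
  shows "f a = f b"
proof -
  have "\<exists>k. \<forall>s\<in>ball c e. f s = k"
    by (rule has_field_derivative_zero_constant)
      (auto intro!: has_field_derivative_at_within assms(1) simp: dist_real_def abs_minus_commute)
  then show ?thesis
    using assms(2,3) by (auto simp: dist_real_def abs_minus_commute)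
qed

text \<open>The output of \<open>contact_derivative\<close> on a cube around one point, split into
  components. All assumptions are pointwise statements about first derivatives, since a
  \<open>C1\<close> map offers no second ones.\<close>

locale contact_box =
  fixes t0 x0 v0 \<delta> :: real and T Y w T1 T2 Y1 Y2 w2 w3 :: "real \<times> real \<times> real \<Rightarrow> real"
    and box :: "real \<Rightarrow> real \<Rightarrow> real \<Rightarrow> bool"
  defines "box t x v \<equiv> \<bar>t - t0\<bar> < \<delta> \<and> \<bar>x - x0\<bar> < \<delta> \<and> \<bar>v - v0\<bar> < \<delta>"
  assumes \<delta>: "\<delta> > 0"
    and T: "box t x v \<Longrightarrow> (T has_derivative
      (\<lambda>h. T1 (t, x, v) * fst h + T2 (t, x, v) * fst (snd h))) (at (t, x, v))"
    and Y: "box t x v \<Longrightarrow> (Y has_derivative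
      (\<lambda>h. Y1 (t, x, v) * fst h + Y2 (t, x, v) * fst (snd h))) (at (t, x, v))"
    and w: "box t x v \<Longrightarrow> (w has_derivative
      (\<lambda>h. w2 (t, x, v) * (fst (snd h) - v * fst h) + w3 (t, x, v) * snd (snd h))) (at (t, x, v))"
    and contact: "box t x v \<Longrightarrow> Y1 (t, x, v) + v * Y2 (t, x, v) = w (t, x, v) * (T1 (t, x, v) + v * T2 (t, x, v))"
    and nonzero: "box t x v \<Longrightarrow> T1 (t, x, v) + v * T2 (t, x, v) \<noteq> 0"
      "box t x v \<Longrightarrow> Y2 (t, x, v) - w (t, x, v) * T2 (t, x, v) \<noteq> 0" "box t x v \<Longrightarrow> w3 (t, x, v) \<noteq> 0"
begin

lemma curve_derivs:
  assumes "box (g1 s) (g2 s) (g3 s)"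
    and g: "(g1 has_real_derivative d1) (at s)" "(g2 has_real_derivative d2) (at s)" "(g3 has_real_derivative d3) (at s)"
  shows "((\<lambda>s. T (g1 s, g2 s, g3 s)) has_real_derivative T1 (g1 s, g2 s, g3 s) * d1 + T2 (g1 s, g2 s, g3 s) * d2) (at s)"
    and "((\<lambda>s. Y (g1 s, g2 s, g3 s)) has_real_derivative Y1 (g1 s, g2 s, g3 s) * d1 + Y2 (g1 s, g2 s, g3 s) * d2) (at s)"
    and "((\<lambda>s. w (g1 s, g2 s, g3 s)) has_real_derivative
      w2 (g1 s, g2 s, g3 s) * (d2 - g3 s * d1) + w3 (g1 s, g2 s, g3 s) * d3) (at s)"
proof -
  show "((\<lambda>s. T (g1 s, g2 s, g3 s)) has_real_derivative T1 (g1 s, g2 s, g3 s) * d1 + T2 (g1 s, g2 s, g3 s) * d2) (at s)"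
    using has_real_derivative_along_curve[where C = 0, OF _ g] T[OF assms(1)] by simp
  show "((\<lambda>s. Y (g1 s, g2 s, g3 s)) has_real_derivative Y1 (g1 s, g2 s, g3 s) * d1 + Y2 (g1 s, g2 s, g3 s) * d2) (at s)"
    using has_real_derivative_along_curve[where C = 0, OF _ g] Y[OF assms(1)] by simp
  have "(w has_derivative (\<lambda>h. - w2 (g1 s, g2 s, g3 s) * g3 s * fst h + w2 (g1 s, g2 s, g3 s) * fst (snd h)
      + w3 (g1 s, g2 s, g3 s) * snd (snd h))) (at (g1 s, g2 s, g3 s))"
    using w[OF assms(1)] by (simp add: algebra_simps)
  from has_real_derivative_along_curve[OF this g]
  show "((\<lambda>s. w (g1 s, g2 s, g3 s)) has_real_derivative
      w2 (g1 s, g2 s, g3 s) * (d2 - g3 s * d1) + w3 (g1 s, g2 s, g3 s) * d3) (at s)"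
    by (simp add: algebra_simps)
qed

lemma fibre_const:
  assumes "box t x v" "box t x v'"
  shows "T (t, x, v) = T (t, x, v')" "Y (t, x, v) = Y (t, x, v')"
proof -
  have b: "box t x s" if "\<bar>s - v0\<bar> < \<delta>" for s
    using assms that by (simp add: box_def)
  have "((\<lambda>s. T (t, x, s)) has_real_derivative 0) (at s)" "((\<lambda>s. Y (t, x, s)) has_real_derivative 0) (at s)"
    if "\<bar>s - v0\<bar> < \<delta>" for s
    using curve_derivs(1,2)[of "\<lambda>_. t" s "\<lambda>_. x" "\<lambda>s. s" 0 0 1] b[OF that] by auto
  then show "T (t, x, v) = T (t, x, v')" "Y (t, x, v) = Y (t, x, v')"
    using assms by (auto intro: constant_of_zero_derivative[where c = v0 and e = \<delta>] simp: box_def)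
qed

lemma box_shift:
  assumes "box t x v"
  obtains e where "e > 0" "\<And>s u. \<bar>s\<bar> < e \<Longrightarrow> box t x u \<Longrightarrow> box (t + s) x u"
    "\<And>s u. \<bar>s\<bar> < e \<Longrightarrow> box t x u \<Longrightarrow> box t (x + s) u"
proof
  let ?e = "min (\<delta> - \<bar>t - t0\<bar>) (\<delta> - \<bar>x - x0\<bar>)"
  show "?e > 0" using assms by (simp add: box_def)
  show "box (t + s) x u" "box t (x + s) u" if "\<bar>s\<bar> < ?e" "box t x u" for s u
    using that by (auto simp: box_def)
qed

text \<open>The coefficients themselves cannot be differentiated in \<open>v\<close>. Instead,
  \<open>T\<close> and \<open>Y\<close> at the heights \<open>v\<close> and \<open>v'\<close>
  coincide near \<open>(t, x)\<close>, so their partial derivatives there do as well.\<close>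

lemma fibre_const_derivs:
  assumes "box t x v" "box t x v'"
  shows "T1 (t, x, v) = T1 (t, x, v')" "T2 (t, x, v) = T2 (t, x, v')"
    "Y1 (t, x, v) = Y1 (t, x, v')" "Y2 (t, x, v) = Y2 (t, x, v')"
proof -
  obtain e where e: "e > 0" "\<And>s u. \<bar>s\<bar> < e \<Longrightarrow> box t x u \<Longrightarrow> box (t + s) x u"
    "\<And>s u. \<bar>s\<bar> < e \<Longrightarrow> box t x u \<Longrightarrow> box t (x + s) u"
    using box_shift[OF assms(1)] by metis
  have shift: "((+) c has_real_derivative 1) (at 0)" for c :: real
    by (auto intro!: derivative_eq_intros)
  have "((\<lambda>s. T (t + s, x, u)) has_real_derivative T1 (t, x, u)) (at 0)"
    "((\<lambda>s. Y (t + s, x, u)) has_real_derivative Y1 (t, x, u)) (at 0)"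
    "((\<lambda>s. T (t, x + s, u)) has_real_derivative T2 (t, x, u)) (at 0)"
    "((\<lambda>s. Y (t, x + s, u)) has_real_derivative Y2 (t, x, u)) (at 0)" if "box t x u" for u
    using curve_derivs(1,2)[of "\<lambda>s. t + s" 0 "\<lambda>_. x" "\<lambda>_. u" 1 0 0]
      curve_derivs(1,2)[of "\<lambda>_. t" 0 "\<lambda>s. x + s" "\<lambda>_. u" 0 1 0] that shift
    by auto
  note d = this[OF assms(1)] this[OF assms(2)]
  have c: "T (t + s, x, v) = T (t + s, x, v')" "Y (t + s, x, v) = Y (t + s, x, v')"
    "T (t, x + s, v) = T (t, x + s, v')" "Y (t, x + s, v) = Y (t, x + s, v')" if "\<bar>s - 0\<bar> < e" for s
    using that e(2,3) assms by (auto intro!: fibre_const)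
  show "T1 (t, x, v) = T1 (t, x, v')" by (rule has_real_derivative_unique_near[OF d(1,5) e(1) c(1)])
  show "Y1 (t, x, v) = Y1 (t, x, v')" by (rule has_real_derivative_unique_near[OF d(2,6) e(1) c(2)])
  show "T2 (t, x, v) = T2 (t, x, v')" by (rule has_real_derivative_unique_near[OF d(3,7) e(1) c(3)])
  show "Y2 (t, x, v) = Y2 (t, x, v')" by (rule has_real_derivative_unique_near[OF d(4,8) e(1) c(4)])
qed

section \<open>Characteristic lines as coordinates\<close>

definition char_pt :: "real \<Rightarrow> real \<Rightarrow> real \<Rightarrow> real \<times> real \<times> real" where
  "char_pt \<tau> c v = (t0 + \<tau>, x0 + c + v * \<tau>, v)"

text \<open>With \<open>\<epsilon> \<le> 1\<close> one has
  \<open>\<bar>v\<bar> \<le> \<bar>v0\<bar> + 1\<close>, hence \<open>\<bar>c + v * \<tau>\<bar>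
  \<le> (2 + \<bar>v0\<bar>) * \<epsilon> < \<delta>\<close>, and \<open>near\<close> parameters
  stay in the box.\<close>

definition \<epsilon> :: real where
  "\<epsilon> = min 1 (\<delta> / (3 + \<bar>v0\<bar>))"

abbreviation near :: "real \<Rightarrow> real \<Rightarrow> real \<Rightarrow> bool" where
  "near \<tau> c v \<equiv> \<bar>\<tau>\<bar> < \<epsilon> \<and> \<bar>c\<bar> < \<epsilon> \<and> \<bar>v - v0\<bar> < \<epsilon>"

lemma \<epsilon>_pos: "\<epsilon> > 0"
  using \<delta> by (simp add: \<epsilon>_def add_pos_nonneg)

lemma near_box:
  assumes "near \<tau> c v"
  shows "box (t0 + \<tau>) (x0 + c + v * \<tau>) v"
proof -
  have "\<epsilon> \<le> \<delta> / (3 + \<bar>v0\<bar>)" and "\<epsilon> \<le> 1"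
    by (simp_all add: \<epsilon>_def)
  then have e: "\<epsilon> * (3 + \<bar>v0\<bar>) \<le> \<delta>" "\<epsilon> \<le> 1"
    using pos_le_divide_eq[of "3 + \<bar>v0\<bar>" \<epsilon> \<delta>] by auto
  have "\<bar>c + v * \<tau>\<bar> \<le> \<bar>c\<bar> + \<bar>v\<bar> * \<bar>\<tau>\<bar>"
    by (metis abs_mult abs_triangle_ineq)
  also have "\<dots> \<le> \<epsilon> + (\<bar>v0\<bar> + 1) * \<epsilon>"
    using assms e by (intro add_mono mult_mono) auto
  also have "\<dots> < \<epsilon> * (3 + \<bar>v0\<bar>)" using \<epsilon>_pos by (simp add: algebra_simps)
  finally have 1: "\<bar>c + v * \<tau>\<bar> < \<delta>" using e by simp
  have "\<epsilon> * 1 \<le> \<epsilon> * (3 + \<bar>v0\<bar>)" using \<epsilon>_pos by (intro mult_left_mono) auto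
  then have "\<epsilon> \<le> \<delta>" using e by simp
  with 1 assms show ?thesis by (simp add: box_def add.assoc)
qed

text \<open>These are slope and intercept of the image line. The derivative of \<open>w\<close>
  kills \<open>(1, v, 0)\<close>, and the derivative of the intercept along a characteristic
  vanishes by \<open>contact\<close>.\<close>

lemma char_const:
  assumes "near \<tau> c v"
  shows "w (char_pt \<tau> c v) = w (char_pt 0 c v)"
    and "Y (char_pt \<tau> c v) - w (char_pt \<tau> c v) * T (char_pt \<tau> c v)
      = Y (char_pt 0 c v) - w (char_pt 0 c v) * T (char_pt 0 c v)"
proof -
  have line: "((\<lambda>\<tau>. t0 + \<tau>) has_real_derivative 1) (at s)"
    "((\<lambda>\<tau>. x0 + c + v * \<tau>) has_real_derivative v) (at s)" "((\<lambda>_. v) has_real_derivative 0) (at s)" for s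
    by (auto intro!: derivative_eq_intros)
  have b: "box (t0 + s) (x0 + c + v * s) v" if "\<bar>s - 0\<bar> < \<epsilon>" for s
    using assms that by (intro near_box) simp
  have dw: "((\<lambda>\<tau>. w (char_pt \<tau> c v)) has_real_derivative 0) (at s)" if "\<bar>s - 0\<bar> < \<epsilon>" for s
    using curve_derivs(3)[OF b[OF that] line] by (simp add: char_pt_def)
  show "w (char_pt \<tau> c v) = w (char_pt 0 c v)"
    using assms \<epsilon>_pos dw by (intro constant_of_zero_derivative[where c = 0 and e = \<epsilon>]) auto
  have "((\<lambda>\<tau>. Y (char_pt \<tau> c v) - w (char_pt \<tau> c v) * T (char_pt \<tau> c v)) has_real_derivative 0) (at s)"
    if "\<bar>s - 0\<bar> < \<epsilon>" for s
  proof -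
    note d = curve_derivs(1,2)[OF b[OF that] line]
    show ?thesis
      using contact[OF b[OF that]] unfolding char_pt_def
      by (intro DERIV_cong[OF DERIV_diff[OF d(2) DERIV_mult[OF dw[OF that, unfolded char_pt_def] d(1)]]])
        (simp add: mult.commute)
  qed
  then show "Y (char_pt \<tau> c v) - w (char_pt \<tau> c v) * T (char_pt \<tau> c v)
      = Y (char_pt 0 c v) - w (char_pt 0 c v) * T (char_pt 0 c v)"
    using assms \<epsilon>_pos by (intro constant_of_zero_derivative[where c = 0 and e = \<epsilon>]) auto
qed

text \<open>\<open>w\<close> and \<open>Y - w T\<close> are functions of the two parameters \<open>c, v\<close> of a characteristic alone;
  comparing their derivatives in \<open>c\<close> and in \<open>v\<close> at the times \<open>\<tau>\<close> and \<open>0\<close> gives these relations.\<close>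

lemma char_deriv_relations:
  assumes "near \<tau> c v"
  shows "w2 (char_pt \<tau> c v) = w2 (char_pt 0 c v)" (is ?A)
    and "w3 (char_pt \<tau> c v) = w3 (char_pt 0 c v) - \<tau> * w2 (char_pt 0 c v)" (is ?B)
    and "Y2 (char_pt \<tau> c v) - w (char_pt \<tau> c v) * T2 (char_pt \<tau> c v) - w2 (char_pt \<tau> c v) * T (char_pt \<tau> c v)
      = Y2 (char_pt 0 c v) - w (char_pt 0 c v) * T2 (char_pt 0 c v) - w2 (char_pt 0 c v) * T (char_pt 0 c v)" (is ?C)
    and "\<tau> * (Y2 (char_pt \<tau> c v) - w (char_pt \<tau> c v) * T2 (char_pt \<tau> c v) - w2 (char_pt \<tau> c v) * T (char_pt \<tau> c v))
      - w3 (char_pt \<tau> c v) * T (char_pt \<tau> c v) = - w3 (char_pt 0 c v) * T (char_pt 0 c v)" (is ?D)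
proof -
  have 0: "near 0 c v" using assms \<epsilon>_pos by simp
  define e where "e = min (\<epsilon> - \<bar>c\<bar>) (\<epsilon> - \<bar>v - v0\<bar>)"
  have nc: "near \<tau> s v" if "\<bar>s - c\<bar> < e" for s
    using assms that by (auto simp: e_def)
  have nv: "near \<tau> c s" if "\<bar>s - v\<bar> < e" for s
    using assms that by (auto simp: e_def)
  have "e > 0" using assms by (simp add: e_def)
  note uniq = has_real_derivative_unique_near[OF _ _ \<open>e > 0\<close>]
  have lc: "((\<lambda>_. t0 + \<sigma>) has_real_derivative 0) (at s)"
    "((\<lambda>c. x0 + c + v * \<sigma>) has_real_derivative 1) (at s)" "((\<lambda>_. v) has_real_derivative 0) (at s)" for \<sigma> s
    by (auto intro!: derivative_eq_intros)
  \<comment> \<open>Changing the slope moves the point at time \<open>\<sigma>\<close> by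
    \<open>\<sigma>\<close> times the change in the \<open>x\<close> direction, whence the factor
    \<open>\<sigma>\<close> in the \<open>v\<close>-derivatives.\<close>
  have lv: "((\<lambda>_. t0 + \<sigma>) has_real_derivative 0) (at s)"
    "((\<lambda>v. x0 + c + v * \<sigma>) has_real_derivative \<sigma>) (at s)" "((\<lambda>v. v) has_real_derivative 1) (at s)" for \<sigma> s
    by (auto intro!: derivative_eq_intros)
  have c: "((\<lambda>c. w (char_pt \<sigma> c v)) has_real_derivative w2 (char_pt \<sigma> c v)) (at c)"
    "((\<lambda>c. Y (char_pt \<sigma> c v) - w (char_pt \<sigma> c v) * T (char_pt \<sigma> c v)) has_real_derivative
      Y2 (char_pt \<sigma> c v) - w (char_pt \<sigma> c v) * T2 (char_pt \<sigma> c v) - w2 (char_pt \<sigma> c v) * T (char_pt \<sigma> c v)) (at c)"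
    if "near \<sigma> c v" for \<sigma>
  proof -
    note d = curve_derivs[OF near_box[OF that] lc]
    show "((\<lambda>c. w (char_pt \<sigma> c v)) has_real_derivative w2 (char_pt \<sigma> c v)) (at c)"
      using d(3) by (simp add: char_pt_def)
    show "((\<lambda>c. Y (char_pt \<sigma> c v) - w (char_pt \<sigma> c v) * T (char_pt \<sigma> c v)) has_real_derivative
      Y2 (char_pt \<sigma> c v) - w (char_pt \<sigma> c v) * T2 (char_pt \<sigma> c v) - w2 (char_pt \<sigma> c v) * T (char_pt \<sigma> c v)) (at c)"
      unfolding char_pt_def
      by (rule DERIV_cong[OF DERIV_diff[OF d(2) DERIV_mult[OF d(3,1)]]]) (simp add: algebra_simps)
  qed
  have v: "((\<lambda>v. w (char_pt \<sigma> c v)) has_real_derivative w2 (char_pt \<sigma> c v) * \<sigma> + w3 (char_pt \<sigma> c v)) (at v)"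
    "((\<lambda>v. Y (char_pt \<sigma> c v) - w (char_pt \<sigma> c v) * T (char_pt \<sigma> c v)) has_real_derivative
      \<sigma> * (Y2 (char_pt \<sigma> c v) - w (char_pt \<sigma> c v) * T2 (char_pt \<sigma> c v) - w2 (char_pt \<sigma> c v) * T (char_pt \<sigma> c v))
      - w3 (char_pt \<sigma> c v) * T (char_pt \<sigma> c v)) (at v)"
    if "near \<sigma> c v" for \<sigma>
  proof -
    note d = curve_derivs[OF near_box[OF that] lv]
    show "((\<lambda>v. w (char_pt \<sigma> c v)) has_real_derivative w2 (char_pt \<sigma> c v) * \<sigma> + w3 (char_pt \<sigma> c v)) (at v)"
      using d(3) by (simp add: char_pt_def)
    show "((\<lambda>v. Y (char_pt \<sigma> c v) - w (char_pt \<sigma> c v) * T (char_pt \<sigma> c v)) has_real_derivative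
      \<sigma> * (Y2 (char_pt \<sigma> c v) - w (char_pt \<sigma> c v) * T2 (char_pt \<sigma> c v) - w2 (char_pt \<sigma> c v) * T (char_pt \<sigma> c v))
      - w3 (char_pt \<sigma> c v) * T (char_pt \<sigma> c v)) (at v)"
      unfolding char_pt_def
      by (rule DERIV_cong[OF DERIV_diff[OF d(2) DERIV_mult[OF d(3,1)]]]) (simp add: algebra_simps)
  qed
  show ?A
    by (rule uniq[OF c(1)[OF assms] c(1)[OF 0] char_const(1)[OF nc]])
  have "w2 (char_pt \<tau> c v) * \<tau> + w3 (char_pt \<tau> c v) = w2 (char_pt 0 c v) * 0 + w3 (char_pt 0 c v)"
    by (rule uniq[OF v(1)[OF assms] v(1)[OF 0] char_const(1)[OF nv]])
  with \<open>?A\<close> show ?B by (simp add: algebra_simps)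
  show ?C
    by (rule uniq[OF c(2)[OF assms] c(2)[OF 0] char_const(2)[OF nc]])
  have "\<tau> * (Y2 (char_pt \<tau> c v) - w (char_pt \<tau> c v) * T2 (char_pt \<tau> c v) - w2 (char_pt \<tau> c v) * T (char_pt \<tau> c v))
      - w3 (char_pt \<tau> c v) * T (char_pt \<tau> c v) = 0 * (Y2 (char_pt 0 c v) - w (char_pt 0 c v) * T2 (char_pt 0 c v)
      - w2 (char_pt 0 c v) * T (char_pt 0 c v)) - w3 (char_pt 0 c v) * T (char_pt 0 c v)"
    by (rule uniq[OF v(2)[OF assms] v(2)[OF 0] char_const(2)[OF nv]])
  then show ?D by simp
qed

end

section \<open>The Jacobian and an affine common denominator\<close>

context contact_box
begin

text \<open>The odd root \<open>root 3\<close> makes sense for a Jacobian of either sign.\<close>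

definition multiplier :: "real \<times> real \<times> real \<Rightarrow> real" where
  "multiplier p = root 3 (1 / (T1 p * Y2 p - T2 p * Y1 p))"

text \<open>For a projective map the Jacobian of its plane part is \<open>det s / lin_form s 3\<^sup>3\<close>, so that the
  multiplier is a candidate for a denominator that is affine in \<open>(t, x)\<close>.\<close>

lemma jacobian_eq:
  assumes "box t x v"
  shows "T1 (t, x, v) * Y2 (t, x, v) - T2 (t, x, v) * Y1 (t, x, v) =
    (T1 (t, x, v) + v * T2 (t, x, v)) * (Y2 (t, x, v) - w (t, x, v) * T2 (t, x, v))"
proof -
  have "Y1 (t, x, v) = w (t, x, v) * (T1 (t, x, v) + v * T2 (t, x, v)) - v * Y2 (t, x, v)"
    using contact[OF assms] by simp
  then show ?thesis by (simp only:) (simp add: algebra_simps)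
qed

lemma multiplier_nonzero:
  assumes "box t x v"
  shows "multiplier (t, x, v) \<noteq> 0"
  unfolding multiplier_def jacobian_eq[OF assms] using nonzero[OF assms] by simp

lemma multiplier_fibre_const:
  assumes "box t x v" "box t x v'"
  shows "multiplier (t, x, v) = multiplier (t, x, v')"
  unfolding multiplier_def fibre_const_derivs[OF assms] ..

text \<open>By \<open>jacobian_eq\<close> the Jacobian is a product of two factors. On one
  characteristic the first times \<open>w3\<close> squared and the second times \<open>w3\<close>
  are constant, so the Jacobian times the cube of \<open>w3\<close> is constant; the cube root is
  odd and gives a constant multiple of \<open>w3\<close>.\<close>

lemma multiplier_on_characteristic:
  assumes "\<bar>c\<bar> < \<epsilon>" "\<bar>v - v0\<bar> < \<epsilon>"
  obtains k a b where "\<And>\<tau>. \<bar>\<tau>\<bar> < \<epsilon> \<Longrightarrow> multiplier (char_pt \<tau> c v) = k * w3 (char_pt \<tau> c v)"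
    "\<And>\<tau>. \<bar>\<tau>\<bar> < \<epsilon> \<Longrightarrow> w3 (char_pt \<tau> c v) * T (char_pt \<tau> c v) = a + b * \<tau>"
proof -
  let ?p = "\<lambda>\<tau>. char_pt \<tau> c v"
  have near: "near \<tau> c v" if "\<bar>\<tau>\<bar> < \<epsilon>" for \<tau> using assms that by simp
  have box: "box (t0 + \<tau>) (x0 + c + v * \<tau>) v" if "\<bar>\<tau>\<bar> < \<epsilon>" for \<tau>
    using near_box near[OF that] .
  define l where "l = Y2 (?p 0) - w (?p 0) * T2 (?p 0)"
  \<comment> \<open>The value at time \<open>0\<close> of the quantity that the third relation of
    \<open>char_deriv_relations\<close> shows to be constant; by the fourth relation it is the slope
    of \<open>w3 * T\<close> in \<open>\<tau>\<close>.\<close>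
  define B where "B = l - w2 (?p 0) * T (?p 0)"
  have w3: "w3 (?p \<tau>) = w3 (?p 0) - \<tau> * w2 (?p 0)" "w3 (?p \<tau>) \<noteq> 0" if "\<bar>\<tau>\<bar> < \<epsilon>" for \<tau>
    using char_deriv_relations(2)[OF near[OF that]] nonzero(3)[OF box[OF that]] by (simp_all add: char_pt_def)
  have l_eq: "Y2 (?p \<tau>) - w (?p \<tau>) * T2 (?p \<tau>) = B + w2 (?p 0) * T (?p \<tau>)" if "\<bar>\<tau>\<bar> < \<epsilon>" for \<tau>
    using char_deriv_relations(1,3)[OF near[OF that]] by (simp add: B_def l_def)
  have T_eq: "w3 (?p \<tau>) * T (?p \<tau>) = w3 (?p 0) * T (?p 0) + B * \<tau>" if "\<bar>\<tau>\<bar> < \<epsilon>" for \<tau>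
  proof -
    note r = char_deriv_relations[OF near[OF that]]
    have "\<tau> * B - w3 (?p \<tau>) * T (?p \<tau>) = - w3 (?p 0) * T (?p 0)"
      using r(4) unfolding r(3) B_def l_def .
    then show ?thesis by (simp add: algebra_simps)
  qed
  have l_w3: "(Y2 (?p \<tau>) - w (?p \<tau>) * T2 (?p \<tau>)) * w3 (?p \<tau>) = l * w3 (?p 0)" if "\<bar>\<tau>\<bar> < \<epsilon>" for \<tau>
  proof -
    have "(Y2 (?p \<tau>) - w (?p \<tau>) * T2 (?p \<tau>)) * w3 (?p \<tau>)
        = B * w3 (?p \<tau>) + w2 (?p 0) * (w3 (?p \<tau>) * T (?p \<tau>))"
      unfolding l_eq[OF that] by (simp add: algebra_simps)
    also have "\<dots> = B * (w3 (?p 0) - \<tau> * w2 (?p 0)) + w2 (?p 0) * (w3 (?p 0) * T (?p 0) + B * \<tau>)"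
      unfolding T_eq[OF that] unfolding w3(1)[OF that] ..
    finally show ?thesis by (simp add: B_def algebra_simps)
  qed
  \<comment> \<open>Along the characteristic \<open>T\<close> is a quotient of two affine functions
    of \<open>\<tau>\<close> with denominator \<open>w3\<close>, so its derivative is a constant
    divided by the square of \<open>w3\<close>.\<close>
  have \<mu>_w3: "(T1 (?p \<tau>) + v * T2 (?p \<tau>)) * (w3 (?p \<tau>))\<^sup>2 = l * w3 (?p 0)" if \<tau>: "\<bar>\<tau>\<bar> < \<epsilon>" for \<tau>
  proof -
    have line: "((\<lambda>\<tau>. t0 + \<tau>) has_real_derivative 1) (at \<tau>)"
      "((\<lambda>\<tau>. x0 + c + v * \<tau>) has_real_derivative v) (at \<tau>)" "((\<lambda>_. v) has_real_derivative 0) (at \<tau>)"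
      by (auto intro!: derivative_eq_intros)
    have d1: "((\<lambda>\<tau>. T (?p \<tau>)) has_real_derivative T1 (?p \<tau>) * 1 + T2 (?p \<tau>) * v) (at \<tau>)"
      unfolding char_pt_def by (rule curve_derivs(1)[OF box[OF \<tau>] line])
    have d2: "((\<lambda>\<tau>. (w3 (?p 0) * T (?p 0) + B * \<tau>) / (w3 (?p 0) - \<tau> * w2 (?p 0))) has_real_derivative
        (B * w3 (?p \<tau>) + w2 (?p 0) * (w3 (?p 0) * T (?p 0) + B * \<tau>)) / (w3 (?p \<tau>) * w3 (?p \<tau>))) (at \<tau>)"
      using w3[OF \<tau>] by (auto intro!: derivative_eq_intros)
    have eq: "T (?p s) = (w3 (?p 0) * T (?p 0) + B * s) / (w3 (?p 0) - s * w2 (?p 0))"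
      if "\<bar>s - \<tau>\<bar> < \<epsilon> - \<bar>\<tau>\<bar>" for s
    proof -
      have s: "\<bar>s\<bar> < \<epsilon>" using that by simp
      show ?thesis
        unfolding w3(1)[OF s, symmetric] T_eq[OF s, symmetric] using w3(2)[OF s] by simp
    qed
    have "T1 (?p \<tau>) * 1 + T2 (?p \<tau>) * v =
        (B * w3 (?p \<tau>) + w2 (?p 0) * (w3 (?p 0) * T (?p 0) + B * \<tau>)) / (w3 (?p \<tau>) * w3 (?p \<tau>))"
      by (rule has_real_derivative_unique_near[where e = "\<epsilon> - \<bar>\<tau>\<bar>", OF d1 d2 _ eq]) (use \<tau> in simp)
    moreover have "B * w3 (?p \<tau>) + w2 (?p 0) * (w3 (?p 0) * T (?p 0) + B * \<tau>) = l * w3 (?p 0)"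
      unfolding w3(1)[OF \<tau>] by (simp add: B_def algebra_simps)
    ultimately show ?thesis
      using w3(2)[OF \<tau>] by (simp add: power2_eq_square mult.commute)
  qed
  define K where "K = (l * w3 (?p 0))\<^sup>2"
  show thesis
  proof (rule that[of "1 / root 3 K"])
    fix \<tau> assume \<tau>: "\<bar>\<tau>\<bar> < \<epsilon>"
    have J: "T1 (?p \<tau>) * Y2 (?p \<tau>) - T2 (?p \<tau>) * Y1 (?p \<tau>) =
      (T1 (?p \<tau>) + v * T2 (?p \<tau>)) * (Y2 (?p \<tau>) - w (?p \<tau>) * T2 (?p \<tau>))" (is "?J = ?m * ?l")
      using jacobian_eq[OF box[OF \<tau>]] by (simp add: char_pt_def)
    have "?J * w3 (?p \<tau>) ^ 3 = (?m * (w3 (?p \<tau>))\<^sup>2) * (?l * w3 (?p \<tau>))"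
      unfolding J by (simp add: power2_eq_square power3_eq_cube)
    also have "\<dots> = K"
      unfolding \<mu>_w3[OF \<tau>] l_w3[OF \<tau>] K_def by (simp add: power2_eq_square)
    finally have JK: "?J * w3 (?p \<tau>) ^ 3 = K" .
    have "?J \<noteq> 0"
      unfolding J using nonzero[OF box[OF \<tau>]] by (simp add: char_pt_def)
    then have "1 / ?J = w3 (?p \<tau>) ^ 3 / K"
      unfolding JK[symmetric] using w3(2)[OF \<tau>] by simp
    then show "multiplier (?p \<tau>) = 1 / root 3 K * w3 (?p \<tau>)"
      by (simp add: multiplier_def real_root_divide odd_real_root_power_cancel)
  next
    fix \<tau> assume "\<bar>\<tau>\<bar> < \<epsilon>"
    then show "w3 (?p \<tau>) * T (?p \<tau>) = w3 (?p 0) * T (?p 0) + B * \<tau>" by (rule T_eq)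
  qed
qed

text \<open>The height is frozen at \<open>v0\<close> so that these are functions of
  \<open>(t, x)\<close>; constancy on fibres still allows lines of every nearby slope
  \<open>v\<close>. The case of \<open>Y\<close> follows from the other two, as \<open>Y\<close> is
  an affine function of \<open>T\<close> on each characteristic.\<close>

lemma multiples_affine_on_characteristics:
  assumes "\<bar>c\<bar> < \<epsilon>" "\<bar>v - v0\<bar> < \<epsilon>"
  shows "\<exists>P Q. \<forall>\<tau>. \<bar>\<tau>\<bar> < \<epsilon> \<longrightarrow> multiplier (t0 + \<tau>, x0 + c + v * \<tau>, v0) = P + Q * \<tau>"
    and "\<exists>P Q. \<forall>\<tau>. \<bar>\<tau>\<bar> < \<epsilon> \<longrightarrow>
      multiplier (t0 + \<tau>, x0 + c + v * \<tau>, v0) * T (t0 + \<tau>, x0 + c + v * \<tau>, v0) = P + Q * \<tau>"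
    and "\<exists>P Q. \<forall>\<tau>. \<bar>\<tau>\<bar> < \<epsilon> \<longrightarrow>
      multiplier (t0 + \<tau>, x0 + c + v * \<tau>, v0) * Y (t0 + \<tau>, x0 + c + v * \<tau>, v0) = P + Q * \<tau>"
proof -
  let ?p = "\<lambda>\<tau>. char_pt \<tau> c v"
  obtain k a b where kab: "\<And>\<tau>. \<bar>\<tau>\<bar> < \<epsilon> \<Longrightarrow> multiplier (?p \<tau>) = k * w3 (?p \<tau>)"
    "\<And>\<tau>. \<bar>\<tau>\<bar> < \<epsilon> \<Longrightarrow> w3 (?p \<tau>) * T (?p \<tau>) = a + b * \<tau>"
    using multiplier_on_characteristic[OF assms] by blast
  define y0 where "y0 = Y (?p 0) - w (?p 0) * T (?p 0)"
  have near: "near \<tau> c v" if "\<bar>\<tau>\<bar> < \<epsilon>" for \<tau> using assms that by simp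
  have fib: "multiplier (t0 + \<tau>, x0 + c + v * \<tau>, v0) = multiplier (?p \<tau>)"
    "T (t0 + \<tau>, x0 + c + v * \<tau>, v0) = T (?p \<tau>)" "Y (t0 + \<tau>, x0 + c + v * \<tau>, v0) = Y (?p \<tau>)"
    if "\<bar>\<tau>\<bar> < \<epsilon>" for \<tau>
  proof -
    have b: "box (t0 + \<tau>) (x0 + c + v * \<tau>) v" using near_box near[OF that] .
    then have b0: "box (t0 + \<tau>) (x0 + c + v * \<tau>) v0" using \<delta> by (simp add: box_def)
    show "multiplier (t0 + \<tau>, x0 + c + v * \<tau>, v0) = multiplier (?p \<tau>)"
      "T (t0 + \<tau>, x0 + c + v * \<tau>, v0) = T (?p \<tau>)" "Y (t0 + \<tau>, x0 + c + v * \<tau>, v0) = Y (?p \<tau>)"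
      unfolding char_pt_def using multiplier_fibre_const[OF b0 b] fibre_const[OF b0 b] by auto
  qed
  have L: "multiplier (?p \<tau>) = k * w3 (?p 0) + (- k * w2 (?p 0)) * \<tau>" if "\<bar>\<tau>\<bar> < \<epsilon>" for \<tau>
    unfolding kab(1)[OF that] char_deriv_relations(2)[OF near[OF that]] by (simp add: algebra_simps)
  have LT: "multiplier (?p \<tau>) * T (?p \<tau>) = k * a + (k * b) * \<tau>" if "\<bar>\<tau>\<bar> < \<epsilon>" for \<tau>
    using kab[OF that] by (simp add: algebra_simps)
  have LY: "multiplier (?p \<tau>) * Y (?p \<tau>) = (y0 * (k * w3 (?p 0)) + w (?p 0) * (k * a))
    + (y0 * (- k * w2 (?p 0)) + w (?p 0) * (k * b)) * \<tau>" if "\<bar>\<tau>\<bar> < \<epsilon>" for \<tau>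
  proof -
    have "Y (?p \<tau>) = y0 + w (?p 0) * T (?p \<tau>)"
      using char_const[OF near[OF that]] by (simp add: y0_def)
    then have "multiplier (?p \<tau>) * Y (?p \<tau>)
        = y0 * multiplier (?p \<tau>) + w (?p 0) * (multiplier (?p \<tau>) * T (?p \<tau>))"
      by (simp add: algebra_simps)
    also have "\<dots> = (y0 * (k * w3 (?p 0)) + w (?p 0) * (k * a))
      + (y0 * (- k * w2 (?p 0)) + w (?p 0) * (k * b)) * \<tau>"
      unfolding LT[OF that] unfolding L[OF that] by (simp add: algebra_simps)
    finally show ?thesis .
  qed
  show "\<exists>P Q. \<forall>\<tau>. \<bar>\<tau>\<bar> < \<epsilon> \<longrightarrow> multiplier (t0 + \<tau>, x0 + c + v * \<tau>, v0) = P + Q * \<tau>"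
    using L fib(1) by metis
  show "\<exists>P Q. \<forall>\<tau>. \<bar>\<tau>\<bar> < \<epsilon> \<longrightarrow>
      multiplier (t0 + \<tau>, x0 + c + v * \<tau>, v0) * T (t0 + \<tau>, x0 + c + v * \<tau>, v0) = P + Q * \<tau>"
    using LT fib(1,2) by metis
  show "\<exists>P Q. \<forall>\<tau>. \<bar>\<tau>\<bar> < \<epsilon> \<longrightarrow>
      multiplier (t0 + \<tau>, x0 + c + v * \<tau>, v0) * Y (t0 + \<tau>, x0 + c + v * \<tau>, v0) = P + Q * \<tau>"
    using LY fib(1,3) by metis
qed

text \<open>The affine expressions for \<open>multiplier * T\<close>, \<open>multiplier * Y\<close>
  and \<open>multiplier\<close> are the rows of \<open>s\<close>, and the nonzero multiplier cancels
  in the quotients.\<close>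

lemma plane_part_projective:
  obtains s \<rho> where "0 < \<rho>" "\<rho> \<le> \<delta>"
    "\<And>t x v. \<bar>t - t0\<bar> < \<rho> \<Longrightarrow> \<bar>x - x0\<bar> < \<rho> \<Longrightarrow> \<bar>v - v0\<bar> < \<delta> \<Longrightarrow>
      lin_form s 3 t x \<noteq> 0 \<and> (T (t, x, v), Y (t, x, v)) = plane_map s (t, x)"
proof -
  obtain a1 b1 c1 \<rho>1 where 1: "\<rho>1 > 0" "\<And>t x. \<bar>t - t0\<bar> < \<rho>1 \<Longrightarrow> \<bar>x - x0\<bar> < \<rho>1 \<Longrightarrow>
      multiplier (t, x, v0) * T (t, x, v0) = a1 * t + b1 * x + c1"
    using affine_on_lines_imp_affine[where f = "\<lambda>t x. multiplier (t, x, v0) * T (t, x, v0)",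
        OF \<epsilon>_pos multiples_affine_on_characteristics(2)] by metis
  obtain a2 b2 c2 \<rho>2 where 2: "\<rho>2 > 0" "\<And>t x. \<bar>t - t0\<bar> < \<rho>2 \<Longrightarrow> \<bar>x - x0\<bar> < \<rho>2 \<Longrightarrow>
      multiplier (t, x, v0) * Y (t, x, v0) = a2 * t + b2 * x + c2"
    using affine_on_lines_imp_affine[where f = "\<lambda>t x. multiplier (t, x, v0) * Y (t, x, v0)",
        OF \<epsilon>_pos multiples_affine_on_characteristics(3)] by metis
  obtain a3 b3 c3 \<rho>3 where 3: "\<rho>3 > 0" "\<And>t x. \<bar>t - t0\<bar> < \<rho>3 \<Longrightarrow> \<bar>x - x0\<bar> < \<rho>3 \<Longrightarrow>
      multiplier (t, x, v0) = a3 * t + b3 * x + c3"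
    using affine_on_lines_imp_affine[where f = "\<lambda>t x. multiplier (t, x, v0)",
        OF \<epsilon>_pos multiples_affine_on_characteristics(1)] by metis
  define \<rho> where "\<rho> = Min {\<rho>1, \<rho>2, \<rho>3, \<delta>}"
  define s :: "real^3^3" where
    "s = vector [vector [a1, b1, c1], vector [a2, b2, c2], vector [a3, b3, c3]]"
  have s: "lin_form s 1 t x = a1 * t + b1 * x + c1" "lin_form s 2 t x = a2 * t + b2 * x + c2"
    "lin_form s 3 t x = a3 * t + b3 * x + c3" for t x
    by (simp_all add: lin_form_def s_def)
  show thesis
  proof (rule that)
    show "0 < \<rho>" "\<rho> \<le> \<delta>" using 1(1) 2(1) 3(1) \<delta> by (auto simp: \<rho>_def)
    fix t x v assume tx: "\<bar>t - t0\<bar> < \<rho>" "\<bar>x - x0\<bar> < \<rho>" and v: "\<bar>v - v0\<bar> < \<delta>"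
    have b: "box t x v0" "box t x v" using tx v \<delta> by (auto simp: \<rho>_def box_def)
    have "lin_form s 1 t x = multiplier (t, x, v0) * T (t, x, v0)"
      "lin_form s 2 t x = multiplier (t, x, v0) * Y (t, x, v0)" "lin_form s 3 t x = multiplier (t, x, v0)"
      unfolding s using 1(2)[of t x] 2(2)[of t x] 3(2)[of t x] tx by (simp_all add: \<rho>_def)
    then show "lin_form s 3 t x \<noteq> 0 \<and> (T (t, x, v), Y (t, x, v)) = plane_map s (t, x)"
      using multiplier_nonzero[OF b(1)] fibre_const[OF b] by (simp add: plane_map_def)
  qed
qed

text \<open>The velocity of \<open>(T, Y)\<close> along a characteristic is computed twice: by
  \<open>contact\<close> it is a nonzero multiple of \<open>(1, w)\<close>, by
  \<open>plane_map_along_line_deriv\<close> a multiple of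
  \<open>(vel_form s 2, vel_form s 1)\<close>.\<close>

lemma velocity_projective:
  assumes \<rho>: "0 < \<rho>" "\<rho> \<le> \<delta>" and s: "\<And>t x v. \<bar>t - t0\<bar> < \<rho> \<Longrightarrow> \<bar>x - x0\<bar> < \<rho> \<Longrightarrow> \<bar>v - v0\<bar> < \<delta> \<Longrightarrow>
      lin_form s 3 t x \<noteq> 0 \<and> (T (t, x, v), Y (t, x, v)) = plane_map s (t, x)"
    and txv: "\<bar>t - t0\<bar> < \<rho>" "\<bar>x - x0\<bar> < \<rho>" "\<bar>v - v0\<bar> < \<delta>"
  shows "vel_form s 2 t x v \<noteq> 0" "w (t, x, v) = vel_form s 1 t x v / vel_form s 2 t x v"
proof -
  let ?L = "lin_form s 3 t x"
  have box: "box t x v" using txv \<rho> by (simp add: box_def)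
  have L: "?L \<noteq> 0" using s[OF txv] by blast
  have g: "((\<lambda>h. t + h) has_real_derivative 1) (at 0)" "((\<lambda>h. x + h * v) has_real_derivative v) (at 0)"
    "((\<lambda>_. v) has_real_derivative 0) (at 0)"
    by (auto intro!: derivative_eq_intros)
  have "box (t + 0) (x + 0 * v) v" using box by simp
  from curve_derivs(1,2)[OF this g]
  have "((\<lambda>h. (T (t + h, x + h * v, v), Y (t + h, x + h * v, v))) has_vector_derivative
      (T1 (t, x, v) + v * T2 (t, x, v), Y1 (t, x, v) + v * Y2 (t, x, v))) (at 0)"
    by (auto intro!: has_vector_derivative_Pair simp: has_real_derivative_iff_has_vector_derivative mult.commute)
  then have "((\<lambda>h. plane_map s (t + h, x + h * v)) has_vector_derivative
      (T1 (t, x, v) + v * T2 (t, x, v), Y1 (t, x, v) + v * Y2 (t, x, v))) (at 0)"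
  proof (rule has_vector_derivative_transform_within_open)
    show "open {h. \<bar>t + h - t0\<bar> < \<rho> \<and> \<bar>x + h * v - x0\<bar> < \<rho>}"
      by (intro open_Collect_conj open_Collect_less continuous_intros)
  qed (use txv s in auto)
  from vector_derivative_unique_at[OF this plane_map_along_line_deriv[OF L]]
  have *: "T1 (t, x, v) + v * T2 (t, x, v) = vel_form s 2 t x v / ?L\<^sup>2"
    "w (t, x, v) * (T1 (t, x, v) + v * T2 (t, x, v)) = vel_form s 1 t x v / ?L\<^sup>2"
    unfolding contact[OF box, symmetric] by blast+
  show nz: "vel_form s 2 t x v \<noteq> 0"
    using * nonzero(1)[OF box] by auto
  have "w (t, x, v) * (vel_form s 2 t x v / ?L\<^sup>2) = vel_form s 1 t x v / ?L\<^sup>2"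
    using *(2) unfolding *(1) .
  then show "w (t, x, v) = vel_form s 1 t x v / vel_form s 2 t x v"
    using nz L by (simp add: nonzero_eq_divide_eq)
qed

text \<open>On one fibre \<open>w\<close> is a fractional linear function of \<open>v\<close>, whose
  determinant is \<open>det s\<close> times a value of \<open>lin_form s 3\<close>. A singular
  \<open>s\<close> would make the \<open>v\<close>-derivative of \<open>w\<close> zero, against
  \<open>w3 \<noteq> 0\<close>.\<close>

lemma projective_matrix_det_nonzero:
  assumes \<rho>: "0 < \<rho>" "\<rho> \<le> \<delta>" and s: "\<And>t x v. \<bar>t - t0\<bar> < \<rho> \<Longrightarrow> \<bar>x - x0\<bar> < \<rho> \<Longrightarrow> \<bar>v - v0\<bar> < \<delta> \<Longrightarrow>
      lin_form s 3 t x \<noteq> 0 \<and> (T (t, x, v), Y (t, x, v)) = plane_map s (t, x)"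
  shows "det s \<noteq> 0"
proof
  assume "det s = 0"
  define A1 B1 A2 B2 where "A1 = - minor_det s 1 3 * t0 + minor_det s 1 1"
    and "B1 = minor_det s 1 3 * x0 + minor_det s 1 2"
    and "A2 = - minor_det s 2 3 * t0 + minor_det s 2 1" and "B2 = minor_det s 2 3 * x0 + minor_det s 2 2"
  have vel: "vel_form s 1 t0 x0 v = A1 * v + B1" "vel_form s 2 t0 x0 v = A2 * v + B2" for v
    by (simp_all add: vel_form_def A1_def B1_def A2_def B2_def)
  have "A1 * B2 - A2 * B1 = det s * lin_form s 3 t0 x0"
    by (simp add: A1_def A2_def B1_def B2_def minor_det_simps det_3 lin_form_def algebra_simps)
  with \<open>det s = 0\<close> have AB: "A1 * B2 = A2 * B1" by simp
  note w = velocity_projective[OF \<rho> s, of t0 x0]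
  have b: "box t0 x0 v0" using \<delta> by (simp add: box_def)
  have "A2 * v0 + B2 \<noteq> 0" using w(1)[of v0] \<rho> \<delta> by (simp add: vel)
  then have "((\<lambda>v. (A1 * v + B1) / (A2 * v + B2)) has_real_derivative
      (A1 * (A2 * v0 + B2) - (A1 * v0 + B1) * A2) / ((A2 * v0 + B2) * (A2 * v0 + B2))) (at v0)"
    by (auto intro!: derivative_eq_intros)
  moreover have "A1 * (A2 * v0 + B2) - (A1 * v0 + B1) * A2 = 0" using AB by (simp add: algebra_simps)
  ultimately have "((\<lambda>v. (A1 * v + B1) / (A2 * v + B2)) has_real_derivative 0) (at v0)" by simp
  moreover have "((\<lambda>v. w (t0, x0, v)) has_real_derivative w3 (t0, x0, v0)) (at v0)"
    using curve_derivs(3)[of "\<lambda>_. t0" v0 "\<lambda>_. x0" "\<lambda>v. v" 0 0 1] b by simp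
  ultimately have "0 = w3 (t0, x0, v0)"
    by (rule has_real_derivative_unique_near[OF _ _ \<delta>]) (use w(2) \<rho> in \<open>simp add: vel\<close>)
  with nonzero(3)[OF b] show False by simp
qed

end

subsection \<open>Local and global projective form\<close>

lemma open_triple_box:
  assumes "open U" "(t0, x0, v0) \<in> U"
  obtains \<delta> :: real where "\<delta> > 0"
    "\<And>t x v. \<bar>t - t0\<bar> < \<delta> \<Longrightarrow> \<bar>x - x0\<bar> < \<delta> \<Longrightarrow> \<bar>v - v0\<bar> < \<delta> \<Longrightarrow> (t, x, v) \<in> U"
proof -
  obtain e where e: "e > 0" "ball (t0, x0, v0) e \<subseteq> U"
    using assms open_contains_ball by blast
  show thesis
  proof (rule that[of "e / 3"])
    fix t x v assume "\<bar>t - t0\<bar> < e / 3" "\<bar>x - x0\<bar> < e / 3" "\<bar>v - v0\<bar> < e / 3"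
    moreover have "norm (t - t0, x - x0, v - v0) \<le> norm (t - t0) + (norm (x - x0) + norm (v - v0))"
      by (meson norm_Pair_le add_left_mono order_trans)
    ultimately have "dist (t, x, v) (t0, x0, v0) < e"
      by (simp add: dist_norm)
    with e show "(t, x, v) \<in> U" by (auto simp: dist_commute)
  qed (use e in simp)
qed

lemma local_projective_form:
  assumes U: "open U" "open V" and diff: "C1_diffeomorphism U V \<Phi>"
    and pres: "preserves_solution_graphs U \<Phi>" and p: "p \<in> U"
  obtains s N where "det s \<noteq> 0" "open N" "p \<in> N" "N \<subseteq> U" "has_projective_form s N \<Phi>"
proof -
  obtain t0 x0 v0 where p_eq: "p = (t0, x0, v0)" by (metis prod.exhaust)
  obtain \<delta> where \<delta>: "\<delta> > 0" and box:
    "\<And>t x v. \<bar>t - t0\<bar> < \<delta> \<Longrightarrow> \<bar>x - x0\<bar> < \<delta> \<Longrightarrow> \<bar>v - v0\<bar> < \<delta> \<Longrightarrow> (t, x, v) \<in> U"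
    using open_triple_box U(1) p p_eq by metis
  define T Y w where "T q = fst (\<Phi> q)" and "Y q = fst (snd (\<Phi> q))" and "w q = snd (snd (\<Phi> q))" for q
  have \<Phi>: "\<Phi> q = (T q, Y q, w q)" for q by (simp add: T_def Y_def w_def)
  \<comment> \<open>Membership in \<open>U\<close> stands below the existential quantifiers so that
    \<open>choice_iff\<close> can turn the coefficients into total functions, as
    \<open>contact_box\<close> expects.\<close>
  have "\<forall>q. \<exists>T1 T2 Y1 Y2 w2 w3. q \<in> U \<longrightarrow>
    (\<Phi> has_derivative (\<lambda>h. (T1 * fst h + T2 * fst (snd h), Y1 * fst h + Y2 * fst (snd h),
      w2 * (fst (snd h) - snd (snd q) * fst h) + w3 * snd (snd h)))) (at q) \<and>
    Y1 + snd (snd q) * Y2 = w q * (T1 + snd (snd q) * T2) \<and> T1 + snd (snd q) * T2 \<noteq> 0 \<and>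
    Y2 - w q * T2 \<noteq> 0 \<and> w3 \<noteq> 0" (is "\<forall>q. \<exists>T1 T2 Y1 Y2 w2 w3. ?R q T1 T2 Y1 Y2 w2 w3")
  proof
    fix q
    show "\<exists>T1 T2 Y1 Y2 w2 w3. ?R q T1 T2 Y1 Y2 w2 w3"
    proof (cases "q \<in> U")
      case True
      obtain t x v where q: "q = (t, x, v)" by (metis prod.exhaust)
      show ?thesis
        by (rule contact_derivative[OF U diff pres True[unfolded q] \<Phi>[of "(t, x, v)"]])
          (unfold q snd_conv, blast)
    qed simp
  qed
  then obtain T1 T2 Y1 Y2 w2 w3 where "\<forall>q. ?R q (T1 q) (T2 q) (Y1 q) (Y2 q) (w2 q) (w3 q)"
    unfolding choice_iff by (elim exE)
  note R = this[THEN spec]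
  interpret contact_box t0 x0 v0 \<delta> T Y w T1 T2 Y1 Y2 w2 w3 "\<lambda>t x v. \<bar>t - t0\<bar> < \<delta> \<and> \<bar>x - x0\<bar> < \<delta> \<and> \<bar>v - v0\<bar> < \<delta>"
  proof unfold_locales
    fix t x v assume "\<bar>t - t0\<bar> < \<delta> \<and> \<bar>x - x0\<bar> < \<delta> \<and> \<bar>v - v0\<bar> < \<delta>"
    then have "(t, x, v) \<in> U" using box by blast
    note r = R[rule_format, OF this, unfolded snd_conv]
    show "Y1 (t, x, v) + v * Y2 (t, x, v) = w (t, x, v) * (T1 (t, x, v) + v * T2 (t, x, v))"
      "T1 (t, x, v) + v * T2 (t, x, v) \<noteq> 0" "Y2 (t, x, v) - w (t, x, v) * T2 (t, x, v) \<noteq> 0" "w3 (t, x, v) \<noteq> 0"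
      using r by blast+
    note d = r[THEN conjunct1]
    show "(T has_derivative (\<lambda>h. T1 (t, x, v) * fst h + T2 (t, x, v) * fst (snd h))) (at (t, x, v))"
      using has_derivative_fst[OF d] by (simp add: T_def[abs_def])
    show "(Y has_derivative (\<lambda>h. Y1 (t, x, v) * fst h + Y2 (t, x, v) * fst (snd h))) (at (t, x, v))"
      using has_derivative_fst[OF has_derivative_snd[OF d]] by (simp add: Y_def[abs_def])
    show "(w has_derivative (\<lambda>h. w2 (t, x, v) * (fst (snd h) - v * fst h) + w3 (t, x, v) * snd (snd h))) (at (t, x, v))"
      using has_derivative_snd[OF has_derivative_snd[OF d]] by (simp add: w_def[abs_def])
  qed (simp_all add: \<delta>)
  obtain s \<rho> where \<rho>: "0 < \<rho>" "\<rho> \<le> \<delta>" and s: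
    "\<And>t x v. \<bar>t - t0\<bar> < \<rho> \<Longrightarrow> \<bar>x - x0\<bar> < \<rho> \<Longrightarrow> \<bar>v - v0\<bar> < \<delta> \<Longrightarrow>
      lin_form s 3 t x \<noteq> 0 \<and> (T (t, x, v), Y (t, x, v)) = plane_map s (t, x)"
    using plane_part_projective by metis
  let ?N = "ball t0 \<rho> \<times> ball x0 \<rho> \<times> ball v0 \<delta>"
  show thesis
  proof (rule that)
    show "det s \<noteq> 0" by (rule projective_matrix_det_nonzero[OF \<rho> s])
    show "open ?N" by (intro open_Times open_ball)
    show "p \<in> ?N" using \<rho> \<delta> by (simp add: p_eq)
    show "?N \<subseteq> U" using box \<rho> by (auto simp: dist_real_def abs_minus_commute)
    have "(t, x, v) \<in> projective_lift_domain s" "\<Phi> (t, x, v) = projective_lift s (t, x, v)"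
      if "(t, x, v) \<in> ?N" for t x v
    proof -
      have b: "\<bar>t - t0\<bar> < \<rho>" "\<bar>x - x0\<bar> < \<rho>" "\<bar>v - v0\<bar> < \<delta>"
        using that by (auto simp: dist_real_def abs_minus_commute)
      show "(t, x, v) \<in> projective_lift_domain s" "\<Phi> (t, x, v) = projective_lift s (t, x, v)"
        using s[OF b] velocity_projective[OF \<rho> s b]
        by (auto simp: projective_lift_domain_def projective_lift_def \<Phi> plane_map_def)
    qed
    then show "has_projective_form s ?N \<Phi>"
      unfolding has_projective_form_def by fast
  qed
qed

section \<open>Uniqueness of the matrix up to scale, and gluing\<close>

text \<open>The second difference at \<open>c\<close> with step \<open>h\<close> isolates
  \<open>p\<close>; a first difference then gives \<open>q\<close>.\<close>

lemma quadratic_zero_on_interval: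
  fixes p q r :: real
  assumes "\<rho> > 0" and z: "\<And>t. \<bar>t - c\<bar> < \<rho> \<Longrightarrow> p * t\<^sup>2 + q * t + r = 0"
  shows "p = 0" "q = 0" "r = 0"
proof -
  define h where "h = \<rho> / 2"
  have h: "h > 0" "h < \<rho>" using assms(1) by (auto simp: h_def)
  have e: "p * c\<^sup>2 + q * c + r = 0" "p * (c + h)\<^sup>2 + q * (c + h) + r = 0"
    "p * (c - h)\<^sup>2 + q * (c - h) + r = 0"
    using z[of c] z[of "c + h"] z[of "c - h"] h by auto
  moreover have "2 * p * (h * h) = (p * (c + h)\<^sup>2 + q * (c + h) + r) + (p * (c - h)\<^sup>2 + q * (c - h) + r)
      - 2 * (p * c\<^sup>2 + q * c + r)"
    by (simp add: power2_eq_square algebra_simps)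
  ultimately have "2 * p * (h * h) = 0" by simp
  then show p: "p = 0" using h by simp
  with e have "q * h = 0" by (simp add: algebra_simps)
  then show "q = 0" using h by simp
  with p e show "r = 0" by simp
qed

text \<open>The matrix \<open>M = r ** s'\<close> has \<open>hom_vec t x\<close> as an eigenvector
  for all \<open>(t, x)\<close> in an open set. The resulting polynomial identities force
  \<open>M\<close> to be scalar.\<close>

lemma projective_matrix_unique:
  assumes inv: "det s \<noteq> 0" and N: "open N" "p \<in> N"
    and forms: "has_projective_form s N \<Phi>" "has_projective_form s' N \<Phi>"
  obtains k where "s' = k *\<^sub>R s"
proof -
  obtain t0 x0 v0 where p_eq: "p = (t0, x0, v0)" by (metis prod.exhaust)
  obtain \<rho> where \<rho>: "\<rho> > 0" and box:
    "\<And>t x v. \<bar>t - t0\<bar> < \<rho> \<Longrightarrow> \<bar>x - x0\<bar> < \<rho> \<Longrightarrow> \<bar>v - v0\<bar> < \<rho> \<Longrightarrow> (t, x, v) \<in> N"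
    using open_triple_box N p_eq by metis
  obtain r where r: "r ** s = mat 1" "s ** r = mat 1"
    using inv invertible_det_nz unfolding invertible_def by blast
  define M where "M = r ** s'"
  have M: "lin_form M 1 t x = t * lin_form M 3 t x" "lin_form M 2 t x = x * lin_form M 3 t x"
    if "\<bar>t - t0\<bar> < \<rho>" "\<bar>x - x0\<bar> < \<rho>" for t x
  proof -
    have "(t, x, v0) \<in> N" using box that \<rho> by simp
    with forms have L: "lin_form s 3 t x \<noteq> 0" "lin_form s' 3 t x \<noteq> 0" "plane_map s (t, x) = plane_map s' (t, x)"
      by (auto simp: has_projective_form_def projective_lift_domain_def projective_lift_def plane_map_def subset_iff)
    obtain a b where ab: "plane_map s (t, x) = (a, b)" by fastforce
    then have "s' *v hom_vec t x = (lin_form s' 3 t x / lin_form s 3 t x) *\<^sub>R (s *v hom_vec t x)"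
      using L by (simp add: hom_vec_plane_map)
    then have "M *v hom_vec t x = (lin_form s' 3 t x / lin_form s 3 t x) *\<^sub>R hom_vec t x"
      unfolding M_def matrix_vector_mul_assoc[symmetric]
      by (simp add: matrix_vector_mult_scaleR) (simp add: matrix_vector_mul_assoc r)
    then show "lin_form M 1 t x = t * lin_form M 3 t x" "lin_form M 2 t x = x * lin_form M 3 t x"
      by (simp_all add: lin_form_eq)
  qed
  \<comment> \<open>For fixed \<open>x\<close> the eigenvector identity is a quadratic in
    \<open>t\<close>; its coefficients are affine in \<open>x\<close> and are then treated by the
    same lemma with leading coefficient \<open>0\<close>.\<close>
  have m1: "M$3$1 = 0 \<and> M$3$2 * x + (M$3$3 - M$1$1) = 0 \<and> M$1$2 * x + M$1$3 = 0" if "\<bar>x - x0\<bar> < \<rho>" for x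
  proof -
    have "M$3$1 * t\<^sup>2 + (M$3$2 * x + (M$3$3 - M$1$1)) * t + - (M$1$2 * x + M$1$3) = 0" if "\<bar>t - t0\<bar> < \<rho>" for t
      using M(1)[OF that \<open>\<bar>x - x0\<bar> < \<rho>\<close>] by (simp add: lin_form_def power2_eq_square algebra_simps)
    from quadratic_zero_on_interval[where c = t0, OF \<rho> this] show ?thesis by simp
  qed
  then have m31: "M$3$1 = 0" using \<rho> by (metis abs_zero diff_self)
  have "0 * x\<^sup>2 + M$3$2 * x + (M$3$3 - M$1$1) = 0" "0 * x\<^sup>2 + M$1$2 * x + M$1$3 = 0" if "\<bar>x - x0\<bar> < \<rho>" for x
    using m1[OF that] by simp_all
  from quadratic_zero_on_interval(2,3)[where c = x0, OF \<rho> this(1)] quadratic_zero_on_interval(2,3)[where c = x0, OF \<rho> this(2)]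
  have m: "M$3$2 = 0" "M$1$1 = M$3$3" "M$1$2 = 0" "M$1$3 = 0" by simp_all
  have m2: "M$2$1 = 0 \<and> (M$2$2 - M$3$3) * x + M$2$3 = 0" if "\<bar>x - x0\<bar> < \<rho>" for x
  proof -
    have "0 * t\<^sup>2 + M$2$1 * t + ((M$2$2 - M$3$3) * x + M$2$3) = 0" if "\<bar>t - t0\<bar> < \<rho>" for t
      using M(2)[OF that \<open>\<bar>x - x0\<bar> < \<rho>\<close>] m m31 by (simp add: lin_form_def algebra_simps)
    from quadratic_zero_on_interval[where c = t0, OF \<rho> this] show ?thesis by simp
  qed
  from m2[of x0] have m21: "M$2$1 = 0" using \<rho> by simp
  have "0 * x\<^sup>2 + (M$2$2 - M$3$3) * x + M$2$3 = 0" if "\<bar>x - x0\<bar> < \<rho>" for x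
    using m2[OF that] by simp
  from quadratic_zero_on_interval(2,3)[where c = x0, OF \<rho> this] have "M$2$2 = M$3$3" "M$2$3 = 0" by simp_all
  with m m31 m21 have M_eq: "M = M$3$3 *\<^sub>R mat 1"
    by (simp add: vec_eq_iff forall_3 mat_def)
  have "s' = s ** M"
    by (simp add: M_def matrix_mul_assoc r)
  also have "\<dots> = s ** (M$3$3 *\<^sub>R mat 1)"
    by (rule arg_cong[OF M_eq])
  also have "\<dots> = M$3$3 *\<^sub>R s"
    by (simp add: vec_eq_iff forall_3 matrix_matrix_mult_def sum_3 mat_def)
  finally have "s' = M$3$3 *\<^sub>R s" .
  then show thesis by (rule that)
qed

text \<open>Linear forms scale by \<open>k\<close> and velocity forms, built from minors of order
  two, by its square, so quotients and zero sets stay the same.\<close>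

lemma has_projective_form_scale:
  assumes "k \<noteq> 0"
  shows "has_projective_form (k *\<^sub>R s) A \<Phi> \<longleftrightarrow> has_projective_form s A \<Phi>"
proof -
  have l: "lin_form (k *\<^sub>R s) i t x = k * lin_form s i t x" for i t x
    by (simp add: lin_form_def algebra_simps)
  have "minor_det (k *\<^sub>R s) i j = k\<^sup>2 * minor_det s i j" for i j
    by (simp add: minor_det_def det_2 power2_eq_square algebra_simps)
  then have v: "vel_form (k *\<^sub>R s) i t x v = k\<^sup>2 * vel_form s i t x v" for i t x v
    by (simp add: vel_form_def algebra_simps)
  show ?thesis
    using assms by (simp add: has_projective_form_def projective_lift_domain_def projective_lift_def l v)
qed

lemma has_projective_form_subset:
  "has_projective_form s A \<Phi> \<Longrightarrow> B \<subseteq> A \<Longrightarrow> has_projective_form s B \<Phi>"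
  by (auto simp: has_projective_form_def)

text \<open>The matrix found near one point is kept, and connectedness spreads it over
  \<open>U\<close>: where its region meets that of another local matrix the two are proportional, so
  it serves on the whole of the other region.\<close>

lemma global_projective_form:
  assumes U: "open U" "connected U" "open V" and diff: "C1_diffeomorphism U V \<Phi>"
    and pres: "preserves_solution_graphs U \<Phi>"
  shows "\<exists>s. invertible s \<and> has_projective_form s U \<Phi>"
proof (cases "U = {}")
  case True
  have "invertible (mat 1 :: real^3^3)" by (simp add: invertible_det_nz)
  with True show ?thesis by (auto simp: has_projective_form_def)
next
  case False
  then obtain a where a: "a \<in> U" by blast
  note loc = local_projective_form[OF U(1,3) diff pres]
  obtain s N where s: "det s \<noteq> 0" "open N" "a \<in> N" "has_projective_form s N \<Phi>"
    using loc[OF a] by metis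
  have "\<exists>N. open N \<and> b \<in> N \<and> has_projective_form s N \<Phi>" if "b \<in> U" for b
  proof (rule connected_induction_simple[OF U(2) a that])
    show "\<exists>N. open N \<and> a \<in> N \<and> has_projective_form s N \<Phi>" using s by blast
    fix c assume "c \<in> U"
    then obtain s' N' where s': "det s' \<noteq> 0" "open N'" "c \<in> N'" "N' \<subseteq> U" "has_projective_form s' N' \<Phi>"
      using loc by metis
    have "has_projective_form s N' \<Phi>" if x: "x \<in> N'" "open N" "x \<in> N" "has_projective_form s N \<Phi>" for x N
    proof -
      have "open (N \<inter> N')" "x \<in> N \<inter> N'" using x s' by auto
      moreover have "has_projective_form s (N \<inter> N') \<Phi>" "has_projective_form s' (N \<inter> N') \<Phi>"
        using x s' has_projective_form_subset by (metis inf_le1, metis inf_le2)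
      ultimately obtain k where k: "s = k *\<^sub>R s'"
        using projective_matrix_unique s'(1) by metis
      with s(1) have "k \<noteq> 0" by (auto simp: det_3)
      with s'(5) show ?thesis unfolding k by (simp add: has_projective_form_scale)
    qed
    then show "\<exists>T. openin (top_of_set U) T \<and> c \<in> T \<and> (\<forall>x\<in>T. \<forall>y\<in>T.
        (\<exists>N. open N \<and> x \<in> N \<and> has_projective_form s N \<Phi>) \<longrightarrow> (\<exists>N. open N \<and> y \<in> N \<and> has_projective_form s N \<Phi>))"
      using s' by (intro exI[of _ N']) (auto simp: openin_open_eq[OF U(1)])
  qed
  then have "has_projective_form s U \<Phi>"
    unfolding has_projective_form_def by blast
  with s(1) show ?thesis by (auto simp: invertible_det_nz)
qed

theorem theorem3:
  "(\<forall>(U :: (real \<times> real \<times> real) set) V \<Phi>.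
      open U \<and> connected U \<and> open V \<and> connected V \<and>
      C1_diffeomorphism U V \<Phi> \<and> preserves_solution_graphs U \<Phi> \<longrightarrow>
      (\<exists>s. invertible s \<and> has_projective_form s U \<Phi>)) \<and>
   (\<forall>s U \<Phi>.
      invertible s \<and> has_projective_form s U \<Phi> \<longrightarrow> preserves_solution_graphs U \<Phi>)"
  using global_projective_form projective_form_preserves_solution_graphs by blast

end
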